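(* Let $n$ be a positive integer and let $\mathsf R=\mathsf R_n$ be the modular vector field on the moduli space $\mathsf T=\mathsf T_n$ of enhanced mirror $n$-folds of the Dwork family, with the coordinates $t_j$ carrying the weights $w_j$ (all as defined in the context). Then $\mathsf R$ is a quasi-homogeneous vector field of degree $2$ on $\mathsf T$; that is, writing $\mathsf R=\sum_{j}\mathsf R^j\frac{\partial}{\partial t_j}$ with $\mathsf R^j\in\mathcal O_{\mathsf T}$, each $\mathsf R^j$ is homogeneous of weight $w_j+2$.
   Context: **The moduli space $\mathsf T$.** Fix $n\ge 1$. Put $m=\frac{n+1}2$ if $n$ is odd, $m=\frac n2$ if $n$ is even; $d=\frac{(n+1)(n+3)}4+1$ if $n$ is odd, $d=\frac{n(n+2)}4+1$ if $n$ is even. $\mathsf T=\mathsf T_n$ is the moduli space of pairs $(X,[\alpha_1,\dots,\alpha_{n+1}])$, where $X$ is a mirror $n$-fold of the Dwork family (desingularized quotient of $t_{n+2}x_0^{n+2}+x_1^{n+2}+\dots+x_{n+1}^{n+2}-(n+2)t_1x_0\cdots x_{n+1}=0$ by the group of $(\zeta_0,\dots,\zeta_{n+1})$ with $\zeta_i^{n+2}=1$, $\prod\zeta_i=1$) and $\alpha_1,\dots,\alpha_{n+1}$ is a basis of $H^n_{\rm dR}(X)$ with $\alpha_i\in F^{n+1-i}\setminus F^{n+2-i}$ (Hodge filtration) and intersection matrix $(\langle\alpha_i,\alpha_j\rangle)=\Phi$, where $\Phi=\begin{pmatrix}0&J_m\\-J_m&0\end{pmatrix}$ for $n$ odd, $\Phi=J_{n+1}$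 for $n$ even, $J_k$ being the $k\times k$ matrix with $1$'s on the antidiagonal and $0$ elsewhere. It has the following explicit description. Let $B$ be the $(n+1)\times(n+1)$ matrix of $1$-forms in $t_1,t_{n+2}$ (Gauss-Manin matrix in a basis $\omega=(\omega_1,\dots,\omega_{n+1})^{\rm tr}$) with entries: $B[i,i]=-\frac{i}{(n+2)t_{n+2}}dt_{n+2}$ and $B[i,i+1]=dt_1-\frac{t_1}{(n+2)t_{n+2}}dt_{n+2}$ for $1\le i\le n$; $B[n+1,j]=\frac{-S_2(n+2,j)t_1^j}{t_1^{n+2}-t_{n+2}}dt_1+\frac{S_2(n+2,j)t_1^{j+1}}{(n+2)t_{n+2}(t_1^{n+2}-t_{n+2})}dt_{n+2}$ for $1\le j\le n$; $B[n+1,n+1]=\frac{-S_2(n+2,n+1)t_1^{n+1}}{t_1^{n+2}-t_{n+2}}dt_1+\frac{\frac{n(n+1)}2t_1^{n+2}+(n+1)t_{n+2}}{(n+2)t_{n+2}(t_1^{n+2}-t_{n+2})}dt_{n+2}$; all other entries $0$. Here $S_2$ denotes Stirling numbers of the second kind. Let $\Omega=(\langle\omega_i,\omega_j\rangle)$ be the $(-1)^n$-symmetric matrix determined by $\Omega_{ij}=0$ for $i+j\le n+1$, $\Omega_{1,n+1}=(-(n+2))^n\frac{c_n}{t_1^{n+2}-t_{n+2}}$ ($c_n$ a fixed nonzero constant), $\Omega_{j,n+2-j}=(-1)^{j-1}\Omega_{1,n+1}$, and $d\Omega=B\Omega+\Omega B^{\rm tr}$. Points of $\mathsf T$ are given by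 $(t_1,t_{n+2})$ with $t_{n+2}(t_1^{n+2}-t_{n+2})\ne0$ and an invertible lower triangular matrix $S=(s_{ij})$ with $s_{11}=1$ and $S\Omega S^{\rm tr}=\Phi$; then $\alpha=S\omega$. Independent coordinates: the entries $s_{ij}$, $i\ge j$, $(i,j)\neq(1,1)$, with $i+j\le n+2$ ($n$ odd) or $i+j<n+2$ ($n$ even), read from left to right and top to bottom, are named $t_2,t_3,\dots$ in order, skipping the index $n+2$ (already used). So $t_2=s_{21}$. Let $I=\{1,\dots,d\}$ if $n\ne2$, $I=\{1,2,4\}$ if $n=2$; $(t_j)_{j\in I}$ is the chart. For $n$ even let in addition $u=s_{\frac{n+2}2\frac{n+2}2}$, so $u^2=\frac{(-1)^{n/2}}{c_n(n+2)^n}(t_1^{n+2}-t_{n+2})$ ($u$ is called $t_{d+1}$, and $t_3$ when $n=2$). All other entries of $S$ are regular functions of these, and $\mathcal O_{\mathsf T}=\mathbb C\big[t_j\,(j\in I),\,u,\,\frac1{t_{n+2}(t_{n+2}-t_1^{n+2})\check t}\big]$ ($u$ present only for $n$ even, subject to its quadratic relation), where $\check t$ is the product of the $m-1$ coordinates $t_j$ lying on the main diagonal of $S$. Vector fields on $\mathsf T$ are $\mathbb C$-derivations of $\mathcal O_{\mathsf T}$, written $\sum_{j\in I}E^j\frac{\partial}{\partial t_j}$ ($\frac{\partial}{\partial t_j}$ extends uniquely to $u$). **Vector fields.** For a vector field $E$ its Gauss-Manin matrix $A_E$ (i.e. $\nabla_E\alpha=A_E\alpha$) is determined by $E(S)=A_ES-S\,B(E)$,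 with $E(S)$ taken entrywise; $E$ is determined by $A_E$. - The modular vector field $\mathsf R$ is the unique vector field for which there are regular functions $\mathsf Y_1,\dots,\mathsf Y_{n-2}$ such that $A_{\mathsf R}=\mathsf Y$, where $\mathsf Y$ has superdiagonal $(1,\mathsf Y_1,\dots,\mathsf Y_{n-2},-1)$ (for $n=2$: $(1,-1)$; for $n=1$: $(1)$) and zeros elsewhere, and $\mathsf Y\Phi+\Phi\mathsf Y^{\rm tr}=0$. - For $\mathfrak g$ upper triangular with $\mathfrak g^{\rm tr}\Phi+\Phi\mathfrak g=0$, $\mathsf R_{\mathfrak g}$ is the unique vector field with $A_{\mathsf R_{\mathfrak g}}=\mathfrak g^{\rm tr}$. With $E_{ij}$ the matrix units put $\mathfrak g_{11}=E_{11}-E_{n+1,n+1}$ and, for $n\ge3$, $\mathfrak g_{22}=E_{22}-E_{nn}$. - $\mathsf H:=-\mathsf R_{\mathfrak g_{11}}$ if $n=1$, $\mathsf H:=-2\mathsf R_{\mathfrak g_{11}}$ if $n=2$, $\mathsf H:=\mathsf R_{\mathfrak g_{22}}-\mathsf R_{\mathfrak g_{11}}$ if $n\ge3$. One has $\mathsf H=\sum_{j\in I}w_jt_j\frac{\partial}{\partial t_j}$ with non-negative integers $w_j$: for $n=1$, $(w_1,w_2,w_3)=(1,2,3)$; for $n=2$, $(w_1,w_2,w_4)=(2,2,8)$; for $n\ge3$, $w_1=1$, $w_{n+2}=n+2$, and if $t_j=s_{ik}$ then $w_j=k+1$ for $i\in\{2,n+1\}$, $w_j=k$ for $3\le i\le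 n-1$, $w_j=k-1$ for $i=n$. **Weights.** $\deg t_j=w_j$, and for $n$ even $\deg u=\frac{n+2}2$ if $n\ge4$, $\deg u=4$ if $n=2$. This makes $\mathcal O_{\mathsf T}$ $\mathbb Z$-graded. A vector field $E=\sum_{j\in I}E^j\frac{\partial}{\partial t_j}$ is quasi-homogeneous of degree $e$ if each $E^j$ is homogeneous of weight $w_j+e$ (zero being allowed). *)

theory Defs
  imports
    "HOL-Analysis.Product_Vector"
    "HOL-Combinatorics.Stirling"
    "Jordan_Normal_Form.Matrix"
begin

section \<open>Matrices with rows and columns numbered from 1\<close>

definition entry :: "'a mat \<Rightarrow> nat \<Rightarrow> nat \<Rightarrow> 'a" where
  "entry M i j = M $$ (i - 1, j - 1)"

definition square :: "nat \<Rightarrow> (nat \<Rightarrow> nat \<Rightarrow> 'a) \<Rightarrow> 'a mat" where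
  "square k f = mat k k (\<lambda>(i, j). f (i + 1) (j + 1))"

definition J_mat :: "nat \<Rightarrow> complex mat" where
  "J_mat k = square k (\<lambda>i j. if i + j = k + 1 then 1 else 0)"

definition Phi :: "nat \<Rightarrow> complex mat" where
  "Phi n = (if odd n
            then (let m = (n + 1) div 2
                  in four_block_mat (0\<^sub>m m m) (J_mat m) (- J_mat m) (0\<^sub>m m m))
            else J_mat (n + 1))"


section \<open>Gauss-Manin and intersection matrices in the basis \<open>\<omega>\<close>\<close>

text \<open>The pairs \<open>(t\<^sub>1, t\<^sub>n\<^sub>+\<^sub>2)\<close> parametrizing smooth fibres.\<close>

definition base :: "nat \<Rightarrow> (complex \<times> complex) set" where
  "base n = {(x, y). y * (x ^ (n + 2) - y) \<noteq> 0}"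

text \<open>A matrix of 1-forms is represented by its values on tangent vectors: in
  \<open>B_mat n (x, y) (dx, dy)\<close> one has \<open>t\<^sub>1 = x\<close>, \<open>t\<^sub>n\<^sub>+\<^sub>2 = y\<close>, and \<open>dx\<close>, \<open>dy\<close> are the values of
  \<open>dt\<^sub>1\<close>, \<open>dt\<^sub>n\<^sub>+\<^sub>2\<close> on the tangent vector.\<close>

fun B_mat :: "nat \<Rightarrow> complex \<times> complex \<Rightarrow> complex \<times> complex \<Rightarrow> complex mat" where
  "B_mat n (x, y) (dx, dy) = square (n + 1) (\<lambda>i j.
     if i \<le> n \<and> j = i then
       - of_nat i / (of_nat (n + 2) * y) * dy
     else if i \<le> n \<and> j = i + 1 then
       dx - x / (of_nat (n + 2) * y) * dy
     else if i = n + 1 \<and> j \<le> n then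
       - of_nat (Stirling (n + 2) j) * x ^ j / (x ^ (n + 2) - y) * dx
       + of_nat (Stirling (n + 2) j) * x ^ (j + 1)
           / (of_nat (n + 2) * y * (x ^ (n + 2) - y)) * dy
     else if i = n + 1 \<and> j = n + 1 then
       - of_nat (Stirling (n + 2) (n + 1)) * x ^ (n + 1) / (x ^ (n + 2) - y) * dx
       + (of_nat (n * (n + 1)) / 2 * x ^ (n + 2) + of_nat (n + 1) * y)
           / (of_nat (n + 2) * y * (x ^ (n + 2) - y)) * dy
     else 0)"

text \<open>The conditions determine \<open>\<Omega>\<close> on \<^term>\<open>base n\<close>: the coefficient of \<open>dt\<^sub>1\<close> in the
  differential equation expresses each row through the previous one. The last condition
  is \<open>d\<Omega> = B \<Omega> + \<Omega> B\<^sup>t\<^sup>r\<close>.\<close>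

definition intersection_matrix ::
  "nat \<Rightarrow> complex \<Rightarrow> (complex \<times> complex \<Rightarrow> complex mat) \<Rightarrow> bool" where
  "intersection_matrix n c \<Omega> \<longleftrightarrow>
     (\<forall>(x, y) \<in> base n.
        \<Omega> (x, y) \<in> carrier_mat (n + 1) (n + 1) \<and>
        transpose_mat (\<Omega> (x, y)) = (- 1) ^ n \<cdot>\<^sub>m \<Omega> (x, y) \<and>
        (\<forall>i \<in> {1..n + 1}. \<forall>j \<in> {1..n + 1}. i + j \<le> n + 1 \<longrightarrow> entry (\<Omega> (x, y)) i j = 0) \<and>
        entry (\<Omega> (x, y)) 1 (n + 1) = (- of_nat (n + 2)) ^ n * c / (x ^ (n + 2) - y) \<and>
        (\<forall>j \<in> {1..n + 1}.
           entry (\<Omega> (x, y)) j (n + 2 - j) = (- 1) ^ (j - 1) * entry (\<Omega> (x, y)) 1 (n + 1)) \<and>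
        (\<forall>i \<in> {1..n + 1}. \<forall>j \<in> {1..n + 1}.
           ((\<lambda>q. entry (\<Omega> q) i j) has_derivative
            (\<lambda>v. entry (B_mat n (x, y) v * \<Omega> (x, y)
                        + \<Omega> (x, y) * transpose_mat (B_mat n (x, y) v)) i j)) (at (x, y))))"


section \<open>The moduli space and its coordinates\<close>

text \<open>A point \<open>(x, y, S)\<close> stands for the fibre over \<open>(t\<^sub>1, t\<^sub>n\<^sub>+\<^sub>2) = (x, y)\<close> with the basis
  \<open>\<alpha> = S \<omega>\<close>.\<close>

type_synonym point = "complex \<times> complex \<times> complex mat"

definition moduli_space :: "nat \<Rightarrow> (complex \<times> complex \<Rightarrow> complex mat) \<Rightarrow> point set" where
  "moduli_space n \<Omega> =
     {(x, y, S). (x, y) \<in> base n \<and>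
        S \<in> carrier_mat (n + 1) (n + 1) \<and> invertible_mat S \<and>
        (\<forall>i \<in> {1..n + 1}. \<forall>j \<in> {1..n + 1}. i < j \<longrightarrow> entry S i j = 0) \<and>
        entry S 1 1 = 1 \<and>
        S * \<Omega> (x, y) * transpose_mat S = Phi n}"

definition dim_T :: "nat \<Rightarrow> nat" where
  "dim_T n = (if odd n then (n + 1) * (n + 3) div 4 + 1 else n * (n + 2) div 4 + 1)"

definition coord_indices :: "nat \<Rightarrow> nat set" where
  "coord_indices n = (if n = 2 then {1, 2, 4} else {1..dim_T n})"

text \<open>Positions of the independent entries of \<open>S\<close>, row by row.\<close>

definition independent_positions :: "nat \<Rightarrow> (nat \<times> nat) list" where
  "independent_positions n =
     filter (\<lambda>(i, k). (i, k) \<noteq> (1, 1) \<and> (if odd n then i + k \<le> n + 2 else i + k < n + 2))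
       (concat (map (\<lambda>i. map (\<lambda>k. (i, k)) [1..<i + 1]) [1..<n + 2]))"

text \<open>The position of \<open>t\<^sub>j\<close> in \<open>S\<close>, for \<open>j \<in> I - {1, n + 2}\<close>; the naming starts with
  \<open>t\<^sub>2\<close> and skips \<open>t\<^sub>n\<^sub>+\<^sub>2\<close>.\<close>

definition position :: "nat \<Rightarrow> nat \<Rightarrow> nat \<times> nat" where
  "position n j = independent_positions n ! (if j < n + 2 then j - 2 else j - 3)"

text \<open>Functions on the moduli space are extended by zero, so that they are equal
  as soon as they agree on it.\<close>

definition on_T :: "nat \<Rightarrow> (complex \<times> complex \<Rightarrow> complex mat) \<Rightarrow> (point \<Rightarrow> complex) \<Rightarrow> (point \<Rightarrow> complex)" where
  "on_T n \<Omega> f = (\<lambda>p. if p \<in> moduli_space n \<Omega> then f p else 0)"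

definition S_fun :: "nat \<Rightarrow> (complex \<times> complex \<Rightarrow> complex mat) \<Rightarrow> nat \<Rightarrow> nat \<Rightarrow> (point \<Rightarrow> complex)" where
  "S_fun n \<Omega> i j = on_T n \<Omega> (\<lambda>(x, y, S). entry S i j)"

definition t_fun :: "nat \<Rightarrow> (complex \<times> complex \<Rightarrow> complex mat) \<Rightarrow> nat \<Rightarrow> (point \<Rightarrow> complex)" where
  "t_fun n \<Omega> j =
     (if j = 1 then on_T n \<Omega> (\<lambda>(x, y, S). x)
      else if j = n + 2 then on_T n \<Omega> (\<lambda>(x, y, S). y)
      else case position n j of (i, k) \<Rightarrow> S_fun n \<Omega> i k)"

text \<open>Only used for even \<open>n\<close>.\<close>

definition u_fun :: "nat \<Rightarrow> (complex \<times> complex \<Rightarrow> complex mat) \<Rightarrow> (point \<Rightarrow> complex)" where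
  "u_fun n \<Omega> = S_fun n \<Omega> ((n + 2) div 2) ((n + 2) div 2)"

text \<open>The localized element \<open>t\<^sub>n\<^sub>+\<^sub>2 (t\<^sub>n\<^sub>+\<^sub>2 - t\<^sub>1\<^sup>n\<^sup>+\<^sup>2) \<check>t\<close>; the last factor \<open>\<check>t\<close> is the product of the
  independent entries on the diagonal of \<open>S\<close>.\<close>

definition denom :: "nat \<Rightarrow> (complex \<times> complex \<Rightarrow> complex mat) \<Rightarrow> (point \<Rightarrow> complex)" where
  "denom n \<Omega> = on_T n \<Omega> (\<lambda>(x, y, S).
     y * (y - x ^ (n + 2)) * (\<Prod>i \<in> {i. (i, i) \<in> set (independent_positions n)}. entry S i i))"


section \<open>Regular functions, grading, vector fields\<close>

text \<open>The coordinate ring of the moduli space, as the algebra of functions generated by its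
  listed generators. The quadratic relation for \<open>u\<close> holds by the definition of
  \<^const>\<open>moduli_space\<close>.\<close>

inductive_set regular :: "nat \<Rightarrow> (complex \<times> complex \<Rightarrow> complex mat) \<Rightarrow> (point \<Rightarrow> complex) set"
  for n :: nat and \<Omega> :: "complex \<times> complex \<Rightarrow> complex mat" where
  regular_const: "on_T n \<Omega> (\<lambda>p. a) \<in> regular n \<Omega>"
| regular_t: "j \<in> coord_indices n \<Longrightarrow> t_fun n \<Omega> j \<in> regular n \<Omega>"
| regular_u: "even n \<Longrightarrow> u_fun n \<Omega> \<in> regular n \<Omega>"
| regular_inverse_denom: "(\<lambda>p. inverse (denom n \<Omega> p)) \<in> regular n \<Omega>"
| regular_add: "f \<in> regular n \<Omega> \<Longrightarrow> g \<in> regular n \<Omega> \<Longrightarrow> (\<lambda>p. f p + g p) \<in> regular n \<Omega>"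
| regular_mult: "f \<in> regular n \<Omega> \<Longrightarrow> g \<in> regular n \<Omega> \<Longrightarrow> (\<lambda>p. f p * g p) \<in> regular n \<Omega>"

text \<open>The weights of the coordinates: \<open>\<Sum>\<^sub>j w\<^sub>j t\<^sub>j \<partial>/\<partial>t\<^sub>j\<close> is the vector field
  \<open>H\<close>, equal to \<open>- R\<^sub>g\<^sub>1\<^sub>1\<close> for \<open>n = 1\<close>, \<open>- 2 R\<^sub>g\<^sub>1\<^sub>1\<close> for \<open>n = 2\<close>, and
  \<open>R\<^sub>g\<^sub>2\<^sub>2 - R\<^sub>g\<^sub>1\<^sub>1\<close> for \<open>n \<ge> 3\<close>.\<close>

definition weight :: "nat \<Rightarrow> nat \<Rightarrow> int" where
  "weight n j =
     (if n = 1 then int j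
      else if n = 2 then (if j = 4 then 8 else 2)
      else if j = 1 then 1
      else if j = n + 2 then int n + 2
      else case position n j of (i, k) \<Rightarrow>
        if i = 2 \<or> i = n + 1 then int k + 1
        else if i = n then int k - 1
        else int k)"

definition weight_u :: "nat \<Rightarrow> int" where
  "weight_u n = (if n = 2 then 4 else (int n + 2) div 2)"

text \<open>\<open>homogeneous n \<Omega> e f\<close>: the function \<open>f\<close> lies in the degree \<open>e\<close> part of the coordinate
  ring, for the grading induced by the weights of the generators.\<close>

inductive homogeneous :: "nat \<Rightarrow> (complex \<times> complex \<Rightarrow> complex mat) \<Rightarrow> int \<Rightarrow> (point \<Rightarrow> complex) \<Rightarrow> bool"
  for n :: nat and \<Omega> :: "complex \<times> complex \<Rightarrow> complex mat" where
  homogeneous_zero: "homogeneous n \<Omega> e (\<lambda>p. 0)"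
| homogeneous_const: "homogeneous n \<Omega> 0 (on_T n \<Omega> (\<lambda>p. a))"
| homogeneous_t: "j \<in> coord_indices n \<Longrightarrow> homogeneous n \<Omega> (weight n j) (t_fun n \<Omega> j)"
| homogeneous_u: "even n \<Longrightarrow> homogeneous n \<Omega> (weight_u n) (u_fun n \<Omega>)"
| homogeneous_inverse_denom:
    "homogeneous n \<Omega> e (denom n \<Omega>) \<Longrightarrow> homogeneous n \<Omega> (- e) (\<lambda>p. inverse (denom n \<Omega> p))"
| homogeneous_add:
    "homogeneous n \<Omega> e f \<Longrightarrow> homogeneous n \<Omega> e g \<Longrightarrow> homogeneous n \<Omega> e (\<lambda>p. f p + g p)"
| homogeneous_mult:
    "homogeneous n \<Omega> e f \<Longrightarrow> homogeneous n \<Omega> e' g \<Longrightarrow> homogeneous n \<Omega> (e + e') (\<lambda>p. f p * g p)"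

definition vector_field ::
  "nat \<Rightarrow> (complex \<times> complex \<Rightarrow> complex mat) \<Rightarrow> ((point \<Rightarrow> complex) \<Rightarrow> (point \<Rightarrow> complex)) \<Rightarrow> bool" where
  "vector_field n \<Omega> E \<longleftrightarrow>
     (\<forall>f \<in> regular n \<Omega>. E f \<in> regular n \<Omega>) \<and>
     (\<forall>f \<in> regular n \<Omega>. \<forall>g \<in> regular n \<Omega>. E (\<lambda>p. f p + g p) = (\<lambda>p. E f p + E g p)) \<and>
     (\<forall>a. \<forall>f \<in> regular n \<Omega>. E (\<lambda>p. a * f p) = (\<lambda>p. a * E f p)) \<and>
     (\<forall>f \<in> regular n \<Omega>. \<forall>g \<in> regular n \<Omega>. E (\<lambda>p. f p * g p) = (\<lambda>p. E f p * g p + f p * E g p))"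

text \<open>\<open>A\<close> is the Gauss-Manin matrix of \<open>E\<close>, that is, \<open>E(S) = A S - S B(E)\<close>.\<close>

definition gauss_manin ::
  "nat \<Rightarrow> (complex \<times> complex \<Rightarrow> complex mat) \<Rightarrow> ((point \<Rightarrow> complex) \<Rightarrow> (point \<Rightarrow> complex))
    \<Rightarrow> (point \<Rightarrow> complex mat) \<Rightarrow> bool" where
  "gauss_manin n \<Omega> E A \<longleftrightarrow>
     (\<forall>(x, y, S) \<in> moduli_space n \<Omega>.
        A (x, y, S) \<in> carrier_mat (n + 1) (n + 1) \<and>
        square (n + 1) (\<lambda>i j. E (S_fun n \<Omega> i j) (x, y, S)) =
          A (x, y, S) * S
          - S * B_mat n (x, y) (E (t_fun n \<Omega> 1) (x, y, S), E (t_fun n \<Omega> (n + 2)) (x, y, S)))"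

text \<open>Superdiagonal \<open>(1, Y\<^sub>1, \<dots>, Y\<^sub>n\<^sub>-\<^sub>2, -1)\<close>; for \<open>n = 1\<close> it is \<open>(1)\<close>.\<close>

definition Y_mat :: "nat \<Rightarrow> (nat \<Rightarrow> point \<Rightarrow> complex) \<Rightarrow> point \<Rightarrow> complex mat" where
  "Y_mat n Y p = square (n + 1) (\<lambda>i j.
     if j = i + 1 then (if i = 1 then 1 else if i = n then - 1 else Y (i - 1) p) else 0)"

definition modular_vector_field ::
  "nat \<Rightarrow> (complex \<times> complex \<Rightarrow> complex mat) \<Rightarrow> ((point \<Rightarrow> complex) \<Rightarrow> (point \<Rightarrow> complex)) \<Rightarrow> bool" where
  "modular_vector_field n \<Omega> R \<longleftrightarrow>
     vector_field n \<Omega> R \<and>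
     (\<exists>Y. (\<forall>k \<in> {1..n - 2}. Y k \<in> regular n \<Omega>) \<and>
          (\<forall>p \<in> moduli_space n \<Omega>.
             Y_mat n Y p * Phi n + Phi n * transpose_mat (Y_mat n Y p) = 0\<^sub>m (n + 1) (n + 1)) \<and>
          gauss_manin n \<Omega> R (Y_mat n Y))"

text \<open>The coefficient of \<open>\<partial>/\<partial>t\<^sub>j\<close> in \<open>E\<close> is \<open>E(t\<^sub>j)\<close>.\<close>

definition quasi_homogeneous ::
  "nat \<Rightarrow> (complex \<times> complex \<Rightarrow> complex mat) \<Rightarrow> int \<Rightarrow> ((point \<Rightarrow> complex) \<Rightarrow> (point \<Rightarrow> complex)) \<Rightarrow> bool" where
  "quasi_homogeneous n \<Omega> e E \<longleftrightarrow>
     (\<forall>j \<in> coord_indices n. homogeneous n \<Omega> (weight n j + e) (E (t_fun n \<Omega> j)))"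

end

theory Submission
  imports Defs "HOL-Analysis.Complex_Transcendental" "Jordan_Normal_Form.Determinant"
begin

text \<open>The vector field \<open>H\<close> integrates to an action of the multiplicative group on the moduli
  space. On the base this holds because the Gauss-Manin matrix along the Euler vector field is
  \<open>- diag(1, \<dots>, n + 1)\<close>, so that each entry of \<open>\<Omega>\<close> satisfies a scalar linear differential equation
  along the orbits. A homogeneous function of degree \<open>e\<close> is an eigenfunction of the action of a
  scalar \<open>z\<close>, with eigenvalue \<open>z\<^sup>e\<close>. Every regular function is a finite sum of homogeneous ones, and for
  \<open>z = 2\<close> these eigenvalues are distinct. A regular function is therefore homogeneous as soon as
  it is an eigenfunction for \<open>z = 2\<close>.

  It remains to see that the functions \<open>R(t\<^sub>j)\<close> are eigenfunctions. The entries \<open>(1, 1)\<close> and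
  \<open>(i, i + 1)\<close> of \<open>R(S) = Y S - S B(R)\<close>, where the left-hand side vanishes, determine \<open>R(t\<^sub>1)\<close>,
  \<open>R(t\<^sub>n\<^sub>+\<^sub>2)\<close> and \<open>Y\<close> in terms of \<open>S\<close>. Their behaviour under the action can be read off, and then the
  equation gives that of all entries of \<open>R(S)\<close>.\<close>

section \<open>Matrices\<close>

lemma square_carrier [simp]: "square k f \<in> carrier_mat k k"
  by (simp add: square_def)

lemma entry_square: "i \<in> {1..k} \<Longrightarrow> j \<in> {1..k} \<Longrightarrow> entry (square k f) i j = f i j"
  by (auto simp: entry_def square_def)

lemma eq_mat_entryI:
  assumes "M \<in> carrier_mat k k" "N \<in> carrier_mat k k"
    and "\<And>i j. i \<in> {1..k} \<Longrightarrow> j \<in> {1..k} \<Longrightarrow> entry M i j = entry N i j"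
  shows "M = N"
proof (rule eq_matI)
  fix i j assume "i < dim_row N" "j < dim_col N"
  then show "M $$ (i, j) = N $$ (i, j)"
    using assms(3)[of "Suc i" "Suc j"] assms(2) by (simp add: entry_def)
qed (use assms in auto)

lemma entry_mult:
  fixes M N :: "'a :: comm_semiring_0 mat"
  assumes "M \<in> carrier_mat k k" "N \<in> carrier_mat k k" "i \<in> {1..k}" "j \<in> {1..k}"
  shows "entry (M * N) i j = (\<Sum>l\<in>{1..k}. entry M i l * entry N l j)"
proof -
  have "entry (M * N) i j = (\<Sum>l\<in>{0..<k}. M $$ (i - 1, l) * N $$ (l, j - 1))"
    using assms by (auto simp: entry_def scalar_prod_def intro!: sum.cong)
  also have "\<dots> = (\<Sum>l\<in>{1..k}. entry M i l * entry N l j)"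
    by (rule sum.reindex_bij_witness[of _ "\<lambda>l. l - 1" Suc]) (auto simp: entry_def)
  finally show ?thesis .
qed

lemma entry_transpose:
  "M \<in> carrier_mat k k \<Longrightarrow> i \<in> {1..k} \<Longrightarrow> j \<in> {1..k} \<Longrightarrow> entry (transpose_mat M) i j = entry M j i"
  by (auto simp: entry_def)

lemma entry_add:
  "M \<in> carrier_mat k k \<Longrightarrow> N \<in> carrier_mat k k \<Longrightarrow> i \<in> {1..k} \<Longrightarrow> j \<in> {1..k} \<Longrightarrow>
    entry (M + N) i j = entry M i j + entry N i j"
  by (auto simp: entry_def)

lemma entry_minus:
  "M \<in> carrier_mat k k \<Longrightarrow> N \<in> carrier_mat k k \<Longrightarrow> i \<in> {1..k} \<Longrightarrow> j \<in> {1..k} \<Longrightarrow>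
    entry (M - N) i j = entry M i j - entry N i j"
  by (auto simp: entry_def)

lemma entry_one:
  "i \<in> {1..k} \<Longrightarrow> j \<in> {1..k} \<Longrightarrow> entry (1\<^sub>m k) i j = (if i = j then 1 else 0)"
  by (auto simp: entry_def)

lemma entry_congruence:
  fixes M W :: "'a :: comm_semiring_0 mat"
  assumes "M \<in> carrier_mat k k" "W \<in> carrier_mat k k" "i \<in> {1..k}" "j \<in> {1..k}"
  shows "entry (M * W * transpose_mat M) i j
    = (\<Sum>l\<in>{1..k}. \<Sum>h\<in>{1..k}. entry M i h * entry W h l * entry M j l)"
  using assms
  by (subst entry_mult[OF _ _ assms(3,4)])
    (auto simp: entry_transpose entry_mult[OF assms(1,2,3)] sum_distrib_right intro!: sum.cong)

text \<open>The rescaled matrix is \<open>diag(a) S diag(b)\<close>, with inverse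
  \<open>diag(1/b) S^-1 diag(1/a)\<close>. The torus will act on \<open>S\<close> in this
  way.\<close>

lemma invertible_mat_rescale:
  fixes S :: "'a :: field mat"
  assumes S: "S \<in> carrier_mat k k" "invertible_mat S"
    and nz: "\<And>i. i \<in> {1..k} \<Longrightarrow> a i \<noteq> 0" "\<And>i. i \<in> {1..k} \<Longrightarrow> b i \<noteq> 0"
  shows "invertible_mat (square k (\<lambda>i j. a i * b j * entry S i j))"
proof -
  obtain N where N: "S * N = 1\<^sub>m k" "N * S = 1\<^sub>m (dim_row N)"
    using S by (auto simp: invertible_mat_def inverts_mat_def)
  \<comment> \<open>\<open>invertible_mat\<close> does not state the size of the inverse; comparing
    dimensions in the two identities recovers it.\<close>
  have dim: "N \<in> carrier_mat k k"
    using N S by (metis carrier_matD(2) carrier_matI index_mult_mat(2,3) index_one_mat(2,3))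
  define S' where "S' = square k (\<lambda>i j. a i * b j * entry S i j)"
  define N' where "N' = square k (\<lambda>i j. inverse (b i) * inverse (a j) * entry N i j)"
  have e1: "(\<Sum>l\<in>{1..k}. entry S i l * entry N l j) = (if i = j then 1 else 0)"
    and e2: "(\<Sum>l\<in>{1..k}. entry N i l * entry S l j) = (if i = j then 1 else 0)"
    if "i \<in> {1..k}" "j \<in> {1..k}" for i j
    using entry_mult[OF S(1) dim that] entry_mult[OF dim S(1) that] entry_one[OF that, where ?'a = 'a] N dim
    by auto
  have "S' * N' = 1\<^sub>m k"
  proof (rule eq_mat_entryI)
    fix i j assume ij: "i \<in> {1..k}" "j \<in> {1..k}"
    have "entry (S' * N') i j = (\<Sum>l\<in>{1..k}. a i * inverse (a j) * (entry S i l * entry N l j))"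
      unfolding S'_def N'_def using ij nz
      by (subst entry_mult[where k = k]) (auto simp: entry_square intro!: sum.cong)
    then show "entry (S' * N') i j = entry (1\<^sub>m k) i j"
      using e1[OF ij] nz(1)[OF ij(1)] ij by (auto simp: sum_distrib_left[symmetric] entry_one)
  qed (use S'_def N'_def in \<open>auto simp: square_def\<close>)
  moreover have "N' * S' = 1\<^sub>m k"
  proof (rule eq_mat_entryI)
    fix i j assume ij: "i \<in> {1..k}" "j \<in> {1..k}"
    have "entry (N' * S') i j = (\<Sum>l\<in>{1..k}. inverse (b i) * b j * (entry N i l * entry S l j))"
      unfolding S'_def N'_def using ij nz
      by (subst entry_mult[where k = k]) (auto simp: entry_square intro!: sum.cong)
    then show "entry (N' * S') i j = entry (1\<^sub>m k) i j"
      using e2[OF ij] nz(2)[OF ij(1)] ij by (auto simp: sum_distrib_left[symmetric] entry_one)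
  qed (use S'_def N'_def in \<open>auto simp: square_def\<close>)
  ultimately show ?thesis
    unfolding invertible_mat_def inverts_mat_def S'_def[symmetric]
    by (intro conjI exI[of _ N']) (auto simp: S'_def N'_def square_def)
qed

text \<open>The nonzero determinant is the product of the diagonal entries. This later permits
  cancelling diagonal entries of \<open>S\<close>.\<close>

lemma lower_triangular_diagonal_nonzero:
  fixes S :: "'a :: field mat"
  assumes S: "S \<in> carrier_mat k k" "invertible_mat S"
    and low: "\<And>i j. i \<in> {1..k} \<Longrightarrow> j \<in> {1..k} \<Longrightarrow> i < j \<Longrightarrow> entry S i j = 0"
    and i: "i \<in> {1..k}"
  shows "entry S i i \<noteq> 0"
proof
  assume 0: "entry S i i = 0"
  obtain N where N: "S * N = 1\<^sub>m k" "N * S = 1\<^sub>m (dim_row N)"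
    using S by (auto simp: invertible_mat_def inverts_mat_def)
  have dim: "N \<in> carrier_mat k k"
    using N S by (metis carrier_matD(2) carrier_matI index_mult_mat(2,3) index_one_mat(2,3))
  have "det S * det N = 1"
    using det_mult[OF S(1) dim] N by simp
  moreover have "det S = prod_list (diag_mat S)"
  proof (rule det_lower_triangular[OF _ S(1)])
    fix i j assume "i < j" "j < k"
    then show "S $$ (i, j) = 0"
      using low[of "Suc i" "Suc j"] by (simp add: entry_def)
  qed
  moreover have "0 \<in> set (diag_mat S)"
    using 0 i S(1) by (auto simp: diag_mat_def entry_def intro!: image_eqI[of _ _ "i - 1"])
  ultimately show False
    by (metis mult_zero_left prod_list_zero_iff zero_neq_one)
qed

text \<open>Off the antidiagonal the factors that the torus puts on rows \<open>i\<close> and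
  \<open>j\<close> need not cancel, so the invariance of \<open>Phi n\<close> rests on these
  zeros.\<close>

lemma entry_Phi:
  assumes "i \<in> {1..n + 1}" "j \<in> {1..n + 1}" "i + j \<noteq> n + 2"
  shows "entry (Phi n) i j = 0"
proof (cases "odd n")
  case True
  then obtain m where m: "n + 1 = 2 * m" by (metis even_Suc evenE Suc_eq_plus1)
  then show ?thesis
    using True assms by (auto simp: Phi_def entry_def J_mat_def square_def Let_def)
next
  case False
  then show ?thesis using assms by (auto simp: Phi_def entry_def J_mat_def square_def)
qed

lemma Phi_carrier: "Phi n \<in> carrier_mat (n + 1) (n + 1)"
proof (cases "odd n")
  case True
  then obtain m where m: "n + 1 = 2 * m" by (metis even_Suc evenE Suc_eq_plus1)
  then show ?thesis
    using True by (auto simp: Phi_def J_mat_def square_def Let_def)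
qed (auto simp: Phi_def J_mat_def)


section \<open>Homogeneity of the Gauss-Manin and intersection matrices\<close>

lemma B_mat_carrier: "B_mat n q v \<in> carrier_mat (n + 1) (n + 1)"
  by (cases q; cases v) simp

text \<open>For weights 1 and n + 2 of t_1 and t_(n+2), the factor \<open>x ^ (n + 2) - y\<close> is
  homogeneous, so its nonvanishing is preserved.\<close>

lemma base_scale:
  assumes "\<mu> \<noteq> 0" "(x, y) \<in> base n"
  shows "(\<mu> * x, \<mu> ^ (n + 2) * y) \<in> base n"
proof -
  have "(\<mu> * x) ^ (n + 2) - \<mu> ^ (n + 2) * y = \<mu> ^ (n + 2) * (x ^ (n + 2) - y)"
    by (simp only: power_mult_distrib right_diff_distrib)
  then show ?thesis using assms unfolding base_def by (auto simp del: power_Suc)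
qed

text \<open>A partition of k + 1 elements into k blocks is the choice of one pair. The value serves
  the corner of \<open>B_mat\<close>, whose dt_1 part carries a Stirling number and whose dt_(n+2)
  part the explicit \<open>n * (n + 1) / 2\<close>.\<close>

lemma Stirling_subdiagonal: "2 * Stirling (Suc k) k = k * Suc k"
  by (induction k) (auto simp: algebra_simps)

text \<open>The entry \<open>(i, j)\<close> of the Gauss-Manin matrix is a 1-form of weight j - i.
  The factor \<kappa> comes out by linearity in the tangent vector; it will be \<open>z ^ 2\<close>,
  the degree of \<open>R\<close>.\<close>

lemma B_mat_scale:
  assumes \<mu>: "\<mu> \<noteq> 0" and xy: "(x, y) \<in> base n" and ij: "i \<in> {1..n + 1}" "j \<in> {1..n + 1}"
  shows "entry (B_mat n (\<mu> * x, \<mu> ^ (n + 2) * y) (\<mu> * \<kappa> * a, \<mu> ^ (n + 2) * \<kappa> * b)) i j * \<mu> ^ i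
    = \<kappa> * \<mu> ^ j * entry (B_mat n (x, y) (a, b)) i j"
proof -
  define P where "P = \<mu> ^ (n + 2)"
  define N where "N = (of_nat (n + 2) :: complex)"
  \<comment> \<open>Replacing \<open>x ^ (n + 2)\<close> by \<open>D + y\<close> leaves identities
    of rational functions whose denominators are products of the nonzero \<open>P\<close>,
    \<open>N\<close>, \<open>y\<close>, \<open>D\<close>.\<close>
  define D where "D = x ^ (n + 2) - y"
  note pows = P_def[symmetric] N_def[symmetric]
  have nz: "P \<noteq> 0" "N \<noteq> 0" "y \<noteq> 0" "D \<noteq> 0"
    using \<mu> xy unfolding P_def N_def D_def base_def by (simp_all only: of_nat_eq_0_iff) auto
  have X: "x ^ (n + 2) = D + y" by (simp add: D_def)
  have X': "(\<mu> * x) ^ (n + 2) = P * (D + y)" by (simp only: power_mult_distrib P_def X)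
  have D': "P * (D + y) - P * y = P * D" by (simp add: algebra_simps)
  note B = B_mat.simps entry_square[OF ij] pows X X' D'
  consider "i \<le> n" "j = i" | "i \<le> n" "j = i + 1" | "i \<le> n" "j \<noteq> i" "j \<noteq> i + 1"
    | "i = n + 1" "j \<le> n" | "i = n + 1" "j = n + 1" using ij by force
  then show ?thesis
  proof cases
    case 1
    have "- of_nat i / (N * (P * y)) * (P * \<kappa> * b) * \<mu> ^ i
        = \<kappa> * \<mu> ^ i * (- of_nat i / (N * y) * b)"
      using nz by (simp add: field_simps)
    with 1 show ?thesis unfolding B by simp
  next
    case 2
    have "(\<mu> * \<kappa> * a - \<mu> * x / (N * (P * y)) * (P * \<kappa> * b)) * \<mu> ^ i
        = \<kappa> * \<mu> ^ (i + 1) * (a - x / (N * y) * b)"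
      using nz by (simp add: field_simps)
    with 2 show ?thesis unfolding B by simp
  next
    case 3
    then show ?thesis unfolding B by simp
  next
    case 4
    have *: "P = \<mu> * \<mu> ^ i" using 4 by (simp add: P_def)
    have "(- s * (\<mu> * x) ^ j / (P * D) * (\<mu> * \<kappa> * a)
          + s * (\<mu> * x) ^ (j + 1) / (N * (P * y) * (P * D)) * (P * \<kappa> * b)) * \<mu> ^ i
        = \<kappa> * \<mu> ^ j * (- s * x ^ j / D * a + s * x ^ (j + 1) / (N * y * D) * b)" for s
      using nz unfolding * power_mult_distrib by (simp add: field_simps)
    from this[of "of_nat (Stirling (n + 2) j)"] 4 show ?thesis unfolding B by (simp del: Stirling.simps)
  next
    case 5
    have *: "P = \<mu> * \<mu> ^ (n + 1)" by (simp add: P_def)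
    have "(- s * (\<mu> * x) ^ (n + 1) / (P * D) * (\<mu> * \<kappa> * a)
          + (r * (P * (D + y)) + t * (P * y)) / (N * (P * y) * (P * D)) * (P * \<kappa> * b)) * \<mu> ^ (n + 1)
        = \<kappa> * \<mu> ^ (n + 1) * (- s * x ^ (n + 1) / D * a + (r * (D + y) + t * y) / (N * y * D) * b)"
      for s r t
      using nz unfolding * power_mult_distrib by (simp add: field_simps)
    from this[of "of_nat (Stirling (n + 2) (n + 1))" "of_nat (n * (n + 1)) / 2" "of_nat (n + 1)"] 5
    show ?thesis unfolding B by (simp del: Stirling.simps)
  qed
qed

text \<open>The tangent vector is \<open>h\<close> times the Euler field. Every nonzero entry off
  the diagonal is a multiple of dt_1 - t_1/((n+2) t_(n+2)) dt_(n+2), which vanishes on it. In the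
  corner the Stirling number has to be evaluated.\<close>

lemma B_mat_Euler:
  assumes xy: "(x, y) \<in> base n" and ij: "i \<in> {1..n + 1}" "j \<in> {1..n + 1}"
  shows "entry (B_mat n (x, y) (h * x, h * (of_nat (n + 2) * y))) i j
    = (if i = j then - of_nat i * h else 0)"
proof -
  define N where "N = (of_nat (n + 2) :: complex)"
  define D where "D = x ^ (n + 2) - y"
  have nz: "N \<noteq> 0" "y \<noteq> 0" "D \<noteq> 0"
    using xy unfolding N_def D_def base_def by (simp_all only: of_nat_eq_0_iff) auto
  have X: "x ^ (n + 2) = D + y" by (simp add: D_def)
  have "2 * Stirling (n + 2) (n + 1) = (n + 1) * (n + 2)"
    using Stirling_subdiagonal[of "n + 1"] by (simp del: Stirling.simps)
  from arg_cong[OF this, of "of_nat :: nat \<Rightarrow> complex"]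
  have S: "of_nat (Stirling (n + 2) (n + 1)) = of_nat (n + 1) * N / 2"
    unfolding of_nat_mult N_def[symmetric]
    by (metis nonzero_mult_div_cancel_left of_nat_numeral zero_neq_numeral)
  note B = B_mat.simps entry_square[OF ij] N_def[symmetric] X S
  consider "i \<le> n" "j = i" | "i \<le> n" "j = i + 1" | "i \<le> n" "j \<noteq> i" "j \<noteq> i + 1"
    | "i = n + 1" "j \<le> n" | "i = n + 1" "j = n + 1" using ij by force
  then show ?thesis
  proof cases
    case 1
    have "- of_nat i / (N * y) * (h * (N * y)) = - of_nat i * h" using nz by simp
    with 1 show ?thesis unfolding B by simp
  next
    case 2
    have "h * x - x / (N * y) * (h * (N * y)) = 0" using nz by simp
    with 2 show ?thesis unfolding B by simp
  next
    case 3
    then show ?thesis unfolding B by simp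
  next
    case 4
    have "- s * x ^ j / D * (h * x) + s * x ^ (j + 1) / (N * y * D) * (h * (N * y)) = 0" for s
      using nz by (simp add: field_simps)
    with 4 show ?thesis unfolding B by simp
  next
    case 5
    have "- (of_nat (n + 1) * N / 2) * x ^ (n + 1) / D * (h * x) = - of_nat (n + 1) * N / 2 * (D + y) / D * h"
      using nz unfolding X[symmetric] by (simp add: field_simps)
    moreover have "\<dots> + (of_nat (n * (n + 1)) / 2 * (D + y) + of_nat (n + 1) * y) / (N * y * D) * (h * (N * y))
        = - of_nat (n + 1) * h"
    proof -
      \<comment> \<open>With \<open>k = n + 1\<close> and \<open>n = N - 2\<close>, the numerators
        over \<open>D\<close> add up to \<open>- k * D\<close>.\<close>
      have "- k * N / 2 * (D + y) / D * h + ((N - 2) * k / 2 * (D + y) + k * y) / (N * y * D) * (h * (N * y))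
        = - k * h" for k
        using nz by (simp add: field_simps)
      moreover have "of_nat (n * (n + 1)) = (N - 2) * of_nat (n + 1)"
        by (simp add: N_def algebra_simps)
      ultimately show ?thesis by (simp only:)
    qed
    ultimately show ?thesis using 5 unfolding B by simp
  qed
qed

lemma intersection_matrix_scale:
  assumes \<Omega>: "intersection_matrix n c \<Omega>" and \<mu>: "\<mu> \<noteq> 0" and xy: "(x, y) \<in> base n"
    and ij: "i \<in> {1..n + 1}" "j \<in> {1..n + 1}"
  shows "\<mu> ^ (i + j) * entry (\<Omega> (\<mu> * x, \<mu> ^ (n + 2) * y)) i j = entry (\<Omega> (x, y)) i j"
proof -
  \<comment> \<open>The orbit of \<open>(x, y)\<close>, parametrized by the exponential so that its
    velocity is the Euler field. The time \<open>s\<close> is complex, so every nonzero \<mu> is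
    reached.\<close>
  define q where "q s = (exp s * x, exp s ^ (n + 2) * y)" for s :: complex
  define f where "f s = entry (\<Omega> (q s)) i j" for s
  have q: "q s \<in> base n" for s
    unfolding q_def by (rule base_scale[OF _ xy]) simp
  have f: "(f has_field_derivative - of_nat (i + j) * f s) (at s)" for s
  proof -
    have dq: "(q has_derivative (\<lambda>h. (h * fst (q s), h * (of_nat (n + 2) * snd (q s))))) (at s)"
      unfolding q_def
      by (auto intro!: derivative_eq_intros simp: algebra_simps fun_eq_iff simp flip: power_Suc)
    let ?v = "\<lambda>h. (h * fst (q s), h * (of_nat (n + 2) * snd (q s)))"
    obtain X Y where XY: "q s = (X, Y)" by (cases "q s")
    have C: "\<Omega> (q s) \<in> carrier_mat (n + 1) (n + 1)"
      and d: "((\<lambda>q. entry (\<Omega> q) i j) has_derivative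
            (\<lambda>v. entry (B_mat n (q s) v * \<Omega> (q s)
                        + \<Omega> (q s) * transpose_mat (B_mat n (q s) v)) i j)) (at (q s))"
      using bspec[OF \<Omega>[unfolded intersection_matrix_def] q[of s]] ij unfolding XY by simp_all
    have "entry (B_mat n (q s) (?v h) * \<Omega> (q s) + \<Omega> (q s) * transpose_mat (B_mat n (q s) (?v h))) i j
      = - of_nat (i + j) * f s * h" for h
    proof -
      define G where "G = B_mat n (q s) (?v h)"
      have B: "G \<in> carrier_mat (n + 1) (n + 1)" unfolding G_def by (rule B_mat_carrier)
      have E: "entry G k l = (if k = l then - of_nat k * h else 0)"
        if "k \<in> {1..n + 1}" "l \<in> {1..n + 1}" for k l
        using B_mat_Euler[of "fst (q s)" "snd (q s)" n k l h] q[of s] that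
        unfolding G_def by simp
      have "entry (G * \<Omega> (q s)) i j = - of_nat i * h * f s"
      proof -
        have "entry (G * \<Omega> (q s)) i j = (\<Sum>l\<in>{1..n + 1}. if i = l then - of_nat i * h * f s else 0)"
          unfolding entry_mult[OF B C ij] f_def using ij by (intro sum.cong) (auto simp: E)
        then show ?thesis using ij by (simp only: sum.delta' finite_atLeastAtMost if_True)
      qed
      moreover have "entry (\<Omega> (q s) * transpose_mat G) i j = - of_nat j * h * f s"
      proof -
        have "entry (\<Omega> (q s) * transpose_mat G) i j
          = (\<Sum>l\<in>{1..n + 1}. if j = l then - of_nat j * h * f s else 0)"
          unfolding entry_mult[OF C transpose_carrier_mat[THEN iffD2, OF B] ij] f_def using ij
          by (intro sum.cong) (auto simp: E entry_transpose[OF B])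
        then show ?thesis using ij by (simp only: sum.delta' finite_atLeastAtMost if_True)
      qed
      ultimately show ?thesis
        unfolding G_def[symmetric] using B C by (subst entry_add[OF _ _ ij]) (auto simp: algebra_simps)
    qed
    with has_derivative_compose[OF dq d] show ?thesis
      by (simp add: f_def[abs_def] has_field_derivative_def)
  qed
  \<comment> \<open>Integrating factor of the equation f' = -(i + j) f: the entry has weight -(i +
    j).\<close>
  have "((\<lambda>s. exp (of_nat (i + j) * s) * f s) has_field_derivative 0) (at s)" for s
    by (auto intro!: derivative_eq_intros f simp: algebra_simps)
  then have "\<exists>k. \<forall>s\<in>UNIV. exp (of_nat (i + j) * s) * f s = k"
    by (intro has_field_derivative_zero_constant) auto
  then obtain k where k: "\<And>s. exp (of_nat (i + j) * s) * f s = k" by auto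
  obtain s where "exp s = \<mu>" using \<mu> exp_Ln by metis
  with k[of s] k[of 0] show ?thesis unfolding exp_of_nat_mult
    by (simp add: f_def q_def)
qed

section \<open>Coordinates and their weights\<close>

text \<open>For \<open>n = 2\<close> the weights (2, 8) of (t_1, t_4) are twice (1, 4); otherwise
  the base has weights (1, n + 2).\<close>

definition base_weight :: "nat \<Rightarrow> nat" where
  "base_weight n = (if n = 2 then 2 else 1)"

text \<open>The diagonal of the Gauss-Manin matrix of \<open>H\<close>.\<close>

definition row_weight :: "nat \<Rightarrow> nat \<Rightarrow> int" where
  "row_weight n i =
     (if i = 1 then - int (base_weight n)
      else if i = n + 1 then int (base_weight n)
      else if n \<ge> 3 \<and> i = 2 then 1
      else if n \<ge> 3 \<and> i = n then - 1
      else 0)"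

text \<open>From H(S) = A S - S B(H), with A diagonal and, by \<open>B_mat_Euler\<close>, B(H) = -
  \<open>base_weight n\<close> * diag(1, ..., n + 1), the entry \<open>(i, k)\<close> of
  \<open>S\<close> is an eigenfunction of H with this eigenvalue.\<close>

definition entry_weight :: "nat \<Rightarrow> nat \<Rightarrow> nat \<Rightarrow> int" where
  "entry_weight n i k = row_weight n i + int (base_weight n * k)"

text \<open>This is A Phi + Phi A^tr = 0 for the diagonal Gauss-Manin matrix A of H; integrated, it
  makes the row scaling preserve \<open>Phi n\<close>.\<close>

lemma row_weight_opposite:
  "n \<ge> 1 \<Longrightarrow> i \<in> {1..n + 1} \<Longrightarrow> i + j = n + 2 \<Longrightarrow> row_weight n i + row_weight n j = 0"
  by (auto simp: row_weight_def)

section \<open>Counting the independent positions and matching them with coordinate indices\<close>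

lemma set_independent_positions:
  "set (independent_positions n) =
    (SIGMA i:{1..n + 1}. {k \<in> {1..i}. if odd n then i + k \<le> n + 2 else i + k < n + 2}) - {(1, 1)}"
proof (rule Set.set_eqI)
  fix p :: "nat \<times> nat"
  obtain i k where p: "p = (i, k)" by (cases p)
  have 1: "set (independent_positions n) =
      {(i, k). i \<in> {1..<n + 2} \<and> k \<in> {1..<i + 1} \<and> (i, k) \<noteq> (1, 1) \<and>
        (if odd n then i + k \<le> n + 2 else i + k < n + 2)}"
    unfolding independent_positions_def set_filter set_concat set_map set_upt by (auto simp: image_iff simp del: upt_Suc)
  show "p \<in> set (independent_positions n) \<longleftrightarrow> p \<in>
    (SIGMA i:{1..n + 1}. {k \<in> {1..i}. if odd n then i + k \<le> n + 2 else i + k < n + 2}) - {(1, 1)}"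
    unfolding 1 p by (simp only: mem_Collect_eq prod.case mem_Sigma_iff Diff_iff) auto
qed

lemma distinct_independent_positions: "distinct (independent_positions n)"
proof -
  have *: "distinct (concat (map (\<lambda>i. map (\<lambda>k. (i, k)) [1..<i + 1]) xs))" if "distinct xs" for xs :: "nat list"
    using that by (induction xs) (auto simp: distinct_map inj_on_def simp del: upt_Suc)
  then show ?thesis unfolding independent_positions_def by (intro distinct_filter * distinct_upt)
qed

text \<open>Row i holds min(i, 2m + 1 - i) admissible positions, where m is (n + 1)/2 or n/2.
  Reflecting the upper half of the range gives twice a triangular number.\<close>

lemma sum_min_complement: "(\<Sum>i\<in>{1..2 * m}. min i (2 * m + 1 - i)) = m * (m + 1)" for m :: nat
proof -
  have "(\<Sum>i\<in>{1..2 * m}. min i (2 * m + 1 - i))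
      = (\<Sum>i\<in>{1..m}. min i (2 * m + 1 - i)) + (\<Sum>i\<in>{m + 1..2 * m}. min i (2 * m + 1 - i))"
    by (subst sum.union_disjoint[symmetric]) (auto intro!: sum.cong)
  also have "(\<Sum>i\<in>{m + 1..2 * m}. min i (2 * m + 1 - i)) = \<Sum>{1..m}"
    by (rule sum.reindex_bij_witness[of _ "\<lambda>i. 2 * m + 1 - i" "\<lambda>i. 2 * m + 1 - i"]) auto
  also have "(\<Sum>i\<in>{1..m}. min i (2 * m + 1 - i)) = \<Sum>{1..m}"
    by (intro sum.cong) auto
  also have "\<Sum>{1..m} + \<Sum>{1..m} = m * (m + 1)"
    by (induction m) auto
  finally show ?thesis .
qed

text \<open>It places the index n + 2 inside \<open>{1..dim_T n}\<close>. For \<open>n = 2\<close>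
  this fails, since \<open>dim_T 2 = 3\<close>, whence the separate index set
  \<open>{1, 2, 4}\<close>.\<close>

lemma dim_T_ge: "n \<ge> 1 \<Longrightarrow> n \<noteq> 2 \<Longrightarrow> n + 2 \<le> dim_T n"
proof -
  assume n: "n \<ge> 1" "n \<noteq> 2"
  show ?thesis
  proof (cases "odd n")
    case True
    have "4 * (n + 1) \<le> (n + 1) * (n + 3)" using n by (simp add: algebra_simps)
    then show ?thesis using True by (simp add: dim_T_def)
  next
    case False
    then have "n \<ge> 4" using n by (cases "n = 3") auto
    then obtain k where "n = k + 4" by (metis le_add_diff_inverse2)
    then have "4 * (n + 1) \<le> n * (n + 2)" by (simp add: algebra_simps)
    then show ?thesis using False by (simp add: dim_T_def)
  qed
qed

text \<open>The two further coordinates are t_1 and t_(n+2). In the count by rows the position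
  \<open>(1, 1)\<close> is included and then removed.\<close>

lemma length_independent_positions:
  assumes "n \<ge> 1"
  shows "length (independent_positions n) + 2 = dim_T n"
proof -
  define c where "c i = {k \<in> {1..i}. if odd n then i + k \<le> n + 2 else i + k < n + 2}" for i
  have fin: "finite (Sigma {1..n + 1} c)" by (auto simp: c_def)
  have mem: "(1, 1) \<in> Sigma {1..n + 1} c" using assms by (auto simp: c_def)
  have "length (independent_positions n) = card (Sigma {1..n + 1} c) - 1"
    using distinct_card[OF distinct_independent_positions, of n] card_Diff_singleton[OF mem]
    unfolding set_independent_positions c_def by simp
  moreover have "card (Sigma {1..n + 1} c) \<ge> 1"
    using fin mem by (metis One_nat_def Suc_leI card_gt_0_iff empty_iff)
  moreover have "card (Sigma {1..n + 1} c) = (\<Sum>i\<in>{1..n + 1}. card (c i))"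
    by (rule card_SigmaI) (auto simp: c_def)
  moreover have "(\<Sum>i\<in>{1..n + 1}. card (c i)) + 1 = dim_T n"
  proof (cases "odd n")
    case True
    then obtain m where m: "n + 1 = 2 * m" by (metis even_Suc evenE Suc_eq_plus1)
    have "card (c i) = min i (2 * m + 1 - i)" if "i \<in> {1..n + 1}" for i
    proof -
      have "c i = {1..min i (2 * m + 1 - i)}" using True m that by (auto simp: c_def)
      then show ?thesis by simp
    qed
    then have "(\<Sum>i\<in>{1..n + 1}. card (c i)) = (\<Sum>i\<in>{1..n + 1}. min i (2 * m + 1 - i))"
      by (intro sum.cong refl)
    then have "(\<Sum>i\<in>{1..n + 1}. card (c i)) = m * (m + 1)"
      unfolding m sum_min_complement .
    moreover have "(n + 1) * (n + 3) = 4 * (m * (m + 1))"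
      using m by (simp add: numeral_3_eq_3 algebra_simps flip: m)
    ultimately show ?thesis using True by (simp add: dim_T_def)
  next
    case False
    then obtain m where m: "n = 2 * m" by (auto elim: evenE)
    have "card (c i) = min i (2 * m + 1 - i)" if "i \<in> {1..n + 1}" for i
    proof -
      have "c i = {1..min i (2 * m + 1 - i)}" using False m that by (auto simp: c_def)
      then show ?thesis by simp
    qed
    then have "(\<Sum>i\<in>{1..n + 1}. card (c i)) = m * (m + 1)"
      using sum_min_complement[of m] by (simp add: m)
    moreover have "n * (n + 2) = 4 * (m * (m + 1))"
      using m by (simp add: algebra_simps)
    ultimately show ?thesis using False by (simp add: dim_T_def)
  qed
  ultimately show ?thesis by linarith
qed

lemma coord_indices_bounds:
  assumes "n \<ge> 1" "j \<in> coord_indices n"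
  shows "1 \<le> j" "n \<noteq> 2 \<Longrightarrow> j \<le> dim_T n" "n = 2 \<Longrightarrow> j = 1 \<or> j = 2 \<or> j = 4"
  using assms by (auto simp: coord_indices_def split: if_splits)

text \<open>The point is that the list access in \<open>position\<close> stays within bounds on both
  sides of the skipped index n + 2.\<close>

lemma position_coord:
  assumes n: "n \<ge> 1" and j: "j \<in> coord_indices n" "j \<noteq> 1" "j \<noteq> n + 2"
  shows "position n j \<in> set (independent_positions n)"
proof -
  have "(if j < n + 2 then j - 2 else j - 3) < length (independent_positions n)"
  proof (cases "n = 2")
    case True
    then show ?thesis
      using length_independent_positions[OF n] coord_indices_bounds(3)[OF n j(1)] j(2,3)
      by (auto simp: dim_T_def)
  next
    case False
    then show ?thesis
      using length_independent_positions[OF n] coord_indices_bounds(1,2)[OF n j(1)] j(2,3)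
        dim_T_ge[OF n]
      by (simp split: if_split) linarith
  qed
  then show ?thesis unfolding position_def by (rule nth_mem)
qed

lemma ex_coord_position:
  assumes n: "n \<ge> 1" and ik: "(i, k) \<in> set (independent_positions n)"
  obtains j where "j \<in> coord_indices n" "j \<noteq> 1" "j \<noteq> n + 2" "position n j = (i, k)"
proof -
  obtain l where l: "l < length (independent_positions n)" "independent_positions n ! l = (i, k)"
    using ik by (auto simp: in_set_conv_nth)
  \<comment> \<open>List indices 0, ..., n - 1 carry the names t_2, ..., t_(n+1); from index n on
    the name n + 2 is skipped.\<close>
  define j where "j = (if l < n then l + 2 else l + 3)"
  show ?thesis
  proof (rule that[of j])
    show "j \<in> coord_indices n"
      using l(1) length_independent_positions[OF n] by (auto simp: coord_indices_def j_def dim_T_def)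
    show "position n j = (i, k)" using l(2) by (auto simp: position_def j_def)
  qed (auto simp: j_def)
qed

section \<open>The weights of the coordinates as weights of entries of \<open>S\<close>\<close>

lemma coord_indices_base:
  assumes "n \<ge> 1"
  shows "1 \<in> coord_indices n" "n + 2 \<in> coord_indices n"
  using dim_T_ge[OF assms] assms by (auto simp: coord_indices_def)

lemma weight_base:
  assumes "n \<ge> 1"
  shows "weight n 1 = int (base_weight n)" "weight n (n + 2) = int (base_weight n * (n + 2))"
  using assms by (auto simp: weight_def base_weight_def)

text \<open>For \<open>n \<ge> 3\<close> the row weights 1, 1, -1 of rows 2, n + 1, n are the
  corrections in the tabulated weights. For \<open>n = 1\<close> and \<open>n = 2\<close> the only
  such coordinate is s_21, of weight 2.\<close>

lemma weight_position:
  assumes n: "n \<ge> 1" and j: "j \<in> coord_indices n" "j \<noteq> 1" "j \<noteq> n + 2"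
    and ik: "position n j = (i, k)"
  shows "weight n j = entry_weight n i k"
proof -
  have mem: "(i, k) \<in> set (independent_positions n)" using position_coord[OF n j] ik by simp
  consider "n = 1" | "n = 2" | "n \<ge> 3" using n by linarith
  then show ?thesis
  proof cases
    case 1
    then have "i = 2" "k = 1" "j = 2"
      using mem j by (auto simp: set_independent_positions coord_indices_def dim_T_def)
    then show ?thesis using 1 by (simp add: weight_def entry_weight_def row_weight_def base_weight_def)
  next
    case 2
    then have "i = 2" "k = 1" "j = 2"
      using mem j by (auto simp: set_independent_positions coord_indices_def)
    then show ?thesis using 2 by (simp add: weight_def entry_weight_def row_weight_def base_weight_def)
  next
    case 3
    then show ?thesis using mem j ik
      by (auto simp: weight_def entry_weight_def row_weight_def base_weight_def set_independent_positions)
  qed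
qed

lemma weight_u_entry:
  assumes "n \<ge> 1" "even n"
  shows "weight_u n = entry_weight n ((n + 2) div 2) ((n + 2) div 2)"
proof -
  obtain m where "n = 2 * m" using assms by (auto elim: evenE)
  then show ?thesis using assms
    by (auto simp: weight_u_def entry_weight_def row_weight_def base_weight_def)
qed

section \<open>The torus action\<close>

text \<open>The flow of H at time log z. Row weights may be negative, hence
  \<open>powi\<close>.\<close>

fun scale :: "nat \<Rightarrow> complex \<Rightarrow> point \<Rightarrow> point" where
  "scale n z (x, y, S) =
    (z ^ base_weight n * x, (z ^ base_weight n) ^ (n + 2) * y,
     square (n + 1) (\<lambda>i k. z powi row_weight n i * (z ^ base_weight n) ^ k * entry S i k))"

lemma powi_entry_weight:
  fixes z :: complex
  assumes "z \<noteq> 0"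
  shows "z powi entry_weight n i k = z powi row_weight n i * (z ^ base_weight n) ^ k"
  using assms unfolding entry_weight_def power_mult[symmetric]
  by (simp add: power_int_add del: of_nat_mult)

text \<open>In S \<Omega> S^tr the column factors \<mu>^(k+l) cancel the weight -(k + l) of
  \<Omega>, and the row factors cancel on the antidiagonal, where \<open>Phi n\<close> lives. The
  normalization s_11 = 1 survives because \<open>entry_weight n 1 1 = 0\<close>.\<close>

lemma scale_moduli_space:
  assumes n: "n \<ge> 1" and \<Omega>: "intersection_matrix n c \<Omega>" and z: "z \<noteq> 0"
    and p: "p \<in> moduli_space n \<Omega>"
  shows "scale n z p \<in> moduli_space n \<Omega>"
proof -
  obtain x y S where p_eq: "p = (x, y, S)" by (cases p)
  define \<mu> where "\<mu> = z ^ base_weight n"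
  define g where "g i = z powi row_weight n i" for i
  have \<mu>: "\<mu> \<noteq> 0" and g: "g i \<noteq> 0" for i using z by (auto simp: \<mu>_def g_def)
  define S' where "S' = square (n + 1) (\<lambda>i k. g i * \<mu> ^ k * entry S i k)"
  define \<Omega>' where "\<Omega>' = \<Omega> (\<mu> * x, \<mu> ^ (n + 2) * y)"
  have S: "(x, y) \<in> base n" "S \<in> carrier_mat (n + 1) (n + 1)" "invertible_mat S"
    "\<And>i j. i \<in> {1..n + 1} \<Longrightarrow> j \<in> {1..n + 1} \<Longrightarrow> i < j \<Longrightarrow> entry S i j = 0"
    "entry S 1 1 = 1" "S * \<Omega> (x, y) * transpose_mat S = Phi n"
    using p unfolding p_eq moduli_space_def by auto
  have base': "(\<mu> * x, \<mu> ^ (n + 2) * y) \<in> base n" by (rule base_scale[OF \<mu> S(1)])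
  have carr: "\<Omega> q \<in> carrier_mat (n + 1) (n + 1)" if "q \<in> base n" for q
    using bspec[OF \<Omega>[unfolded intersection_matrix_def] that] by (cases q) simp
  have C: "\<Omega> (x, y) \<in> carrier_mat (n + 1) (n + 1)" "\<Omega>' \<in> carrier_mat (n + 1) (n + 1)"
    using carr[OF S(1)] carr[OF base'] by (auto simp: \<Omega>'_def)
  have S': "S' \<in> carrier_mat (n + 1) (n + 1)" by (simp only: S'_def square_carrier)
  have S'_entry: "entry S' i k = g i * \<mu> ^ k * entry S i k"
    if "i \<in> {1..n + 1}" "k \<in> {1..n + 1}" for i k
    unfolding S'_def by (rule entry_square[OF that])
  have inv: "invertible_mat S'"
    unfolding S'_def by (rule invertible_mat_rescale[OF S(2,3) g]) (simp add: \<mu>)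
  have "S' * \<Omega>' * transpose_mat S' = Phi n"
  proof (rule eq_mat_entryI[OF _ Phi_carrier])
    fix i j assume ij: "i \<in> {1..n + 1}" "j \<in> {1..n + 1}"
    have t: "entry S' i k * entry \<Omega>' k l * entry S' j l
        = g i * g j * (entry S i k * entry (\<Omega> (x, y)) k l * entry S j l)"
      if "k \<in> {1..n + 1}" "l \<in> {1..n + 1}" for k l
    proof -
      have "\<mu> ^ (k + l) * entry \<Omega>' k l = entry (\<Omega> (x, y)) k l"
        unfolding \<Omega>'_def by (rule intersection_matrix_scale[OF \<Omega> \<mu> S(1) that])
      then show ?thesis unfolding S'_entry[OF ij(1) that(1)] S'_entry[OF ij(2) that(2)]
        by (simp add: power_add mult_ac)
    qed
    have "entry (S' * \<Omega>' * transpose_mat S') i j = g i * g j * entry (S * \<Omega> (x, y) * transpose_mat S) i j"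
      unfolding entry_congruence[OF S' C(2) ij] entry_congruence[OF S(2) C(1) ij] sum_distrib_left
      by (intro sum.cong refl t)
    also have "\<dots> = entry (Phi n) i j"
    proof (cases "i + j = n + 2")
      case True
      then have "g i * g j = 1"
        using row_weight_opposite[OF n ij(1)] z unfolding g_def by (simp flip: power_int_add)
      then show ?thesis by (simp add: S(6))
    next
      case False
      then show ?thesis using entry_Phi[OF ij] by (simp add: S(6))
    qed
    finally show "entry (S' * \<Omega>' * transpose_mat S') i j = entry (Phi n) i j" .
  qed (use S' C(2) in auto)
  moreover have "entry S' 1 1 = 1"
    using S'_entry[of 1 1] S(5) powi_entry_weight[OF z, of n 1 1]
    by (simp add: g_def \<mu>_def entry_weight_def row_weight_def)
  moreover have "entry S' i j = 0" if "i \<in> {1..n + 1}" "j \<in> {1..n + 1}" "i < j" for i j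
    using S'_entry[OF that(1,2)] S(4)[OF that] by simp
  moreover have "scale n z p = (\<mu> * x, \<mu> ^ (n + 2) * y, S')"
    by (simp add: p_eq S'_def g_def \<mu>_def)
  ultimately show ?thesis
    using base' S' inv unfolding moduli_space_def \<Omega>'_def by simp
qed

text \<open>All generators are extended by zero; for the inverse of \<open>denom\<close> this uses
  \<open>inverse 0 = 0\<close>.\<close>

lemma regular_vanishes: "f \<in> regular n \<Omega> \<Longrightarrow> p \<notin> moduli_space n \<Omega> \<Longrightarrow> f p = 0"
  by (induction rule: regular.induct)
    (auto simp: on_T_def t_fun_def S_fun_def u_fun_def denom_def split: prod.split)

lemma homogeneous_vanishes: "homogeneous n \<Omega> e f \<Longrightarrow> p \<notin> moduli_space n \<Omega> \<Longrightarrow> f p = 0"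
  by (induction rule: homogeneous.induct)
    (auto simp: on_T_def t_fun_def S_fun_def u_fun_def denom_def split: prod.split)

section \<open>Effect of the action on coordinates and on homogeneous functions\<close>

lemma S_fun_scale:
  assumes T: "scale n z p \<in> moduli_space n \<Omega>" "p \<in> moduli_space n \<Omega>" and z: "z \<noteq> 0"
    and ik: "i \<in> {1..n + 1}" "k \<in> {1..n + 1}"
  shows "S_fun n \<Omega> i k (scale n z p) = z powi entry_weight n i k * S_fun n \<Omega> i k p"
proof -
  obtain x y S where p: "p = (x, y, S)" by (cases p)
  show ?thesis
    using T unfolding p S_fun_def on_T_def scale.simps
    by (simp only: if_True prod.case powi_entry_weight[OF z] entry_square[OF ik])
qed

lemma t_fun_base_scale:
  assumes T: "scale n z p \<in> moduli_space n \<Omega>" "p \<in> moduli_space n \<Omega>" and n: "n \<ge> 1"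
  shows "t_fun n \<Omega> 1 (scale n z p) = z powi weight n 1 * t_fun n \<Omega> 1 p"
    and "t_fun n \<Omega> (n + 2) (scale n z p) = z powi weight n (n + 2) * t_fun n \<Omega> (n + 2) p"
proof -
  obtain x y S where p: "p = (x, y, S)" by (cases p)
  then show "t_fun n \<Omega> 1 (scale n z p) = z powi weight n 1 * t_fun n \<Omega> 1 p"
    and "t_fun n \<Omega> (n + 2) (scale n z p) = z powi weight n (n + 2) * t_fun n \<Omega> (n + 2) p"
    using T unfolding weight_base[OF n] power_int_of_nat power_mult
    by (simp_all add: t_fun_def on_T_def)
qed

lemma t_fun_coord:
  assumes n: "n \<ge> 1" and j: "j \<in> coord_indices n" "j \<noteq> 1" "j \<noteq> n + 2"
  obtains i k where "i \<in> {1..n + 1}" "k \<in> {1..n + 1}" "position n j = (i, k)"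
    "t_fun n \<Omega> j = S_fun n \<Omega> i k" "weight n j = entry_weight n i k"
proof -
  obtain i k where ik: "position n j = (i, k)" by (cases "position n j")
  then have "(i, k) \<in> set (independent_positions n)" using position_coord[OF n j] by simp
  then show ?thesis
    using that[OF _ _ ik _ weight_position[OF n j ik]] ik j
    by (auto simp: set_independent_positions t_fun_def)
qed

lemma homogeneous_scale:
  assumes n: "n \<ge> 1" and \<Omega>: "intersection_matrix n c \<Omega>" and z: "z \<noteq> 0"
    and f: "homogeneous n \<Omega> e f" and p: "p \<in> moduli_space n \<Omega>"
  shows "f (scale n z p) = z powi e * f p"
proof -
  note T = scale_moduli_space[OF n \<Omega> z p] p
  show ?thesis using f
  proof (induction rule: homogeneous.induct)
    case (homogeneous_t j)
    consider "j = 1" | "j = n + 2" | "j \<noteq> 1" "j \<noteq> n + 2" by blast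
    then show ?case
    proof cases
      case 3
      then obtain i k where "i \<in> {1..n + 1}" "k \<in> {1..n + 1}"
        "t_fun n \<Omega> j = S_fun n \<Omega> i k" "weight n j = entry_weight n i k"
        using t_fun_coord[OF n homogeneous_t] by metis
      then show ?thesis using S_fun_scale[OF T z] by simp
    qed (use t_fun_base_scale[OF T n] in auto)
  next
    case homogeneous_u
    then show ?case
      unfolding u_fun_def weight_u_entry[OF n homogeneous_u] using n
      by (intro S_fun_scale[OF T z]) auto
  next
    case (homogeneous_inverse_denom e)
    then show ?case by (simp add: power_int_minus)
  next
    case homogeneous_add
    then show ?case by (simp add: algebra_simps)
  next
    case homogeneous_mult
    then show ?case using z by (simp add: power_int_add)
  qed (use T in \<open>auto simp: on_T_def\<close>)
qed


section \<open>Decomposition into homogeneous components\<close>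

lemma homogeneous_cmult:
  assumes "homogeneous n \<Omega> e f"
  shows "homogeneous n \<Omega> e (\<lambda>p. a * f p)"
proof -
  \<comment> \<open>The scalar enters as a constant function on the moduli space, extended by zero;
    off that space \<open>f\<close> vanishes anyway.\<close>
  have "(\<lambda>p. a * f p) = (\<lambda>p. on_T n \<Omega> (\<lambda>p. a) p * f p)"
    using homogeneous_vanishes[OF assms] by (auto simp: on_T_def)
  then show ?thesis
    using homogeneous_mult[OF homogeneous_const assms, of a] by simp
qed

text \<open>The factor \<open>g\<close> covers the empty product: the constant 1 does not vanish off
  the moduli space and so is not homogeneous as a function of all points.\<close>

lemma homogeneous_mult_prod:
  assumes "finite I" "\<And>i. i \<in> I \<Longrightarrow> homogeneous n \<Omega> (w i) (f i)" "homogeneous n \<Omega> d g"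
  shows "homogeneous n \<Omega> (d + (\<Sum>i\<in>I. w i)) (\<lambda>p. g p * (\<Prod>i\<in>I. f i p))"
  using assms
proof (induction I rule: finite_induct)
  case (insert i I)
  then have "homogeneous n \<Omega> ((d + (\<Sum>i\<in>I. w i)) + w i) (\<lambda>p. (g p * (\<Prod>i\<in>I. f i p)) * f i p)"
    by (intro homogeneous_mult[where f = "\<lambda>p. g p * (\<Prod>i\<in>I. f i p)"]) auto
  then show ?case using insert by (simp add: algebra_simps)
qed simp

text \<open>The rule for the inverse of \<open>denom\<close> presupposes this. Both \<open>y\<close>
  and \<open>x ^ (n + 2)\<close> have the weight of t_(n+2), and the diagonal factors are
  coordinates.\<close>

lemma homogeneous_denom:
  assumes n: "n \<ge> 1"
  shows "\<exists>d. homogeneous n \<Omega> d (denom n \<Omega>)"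
proof -
  let ?x = "t_fun n \<Omega> 1" and ?y = "t_fun n \<Omega> (n + 2)"
  have x: "homogeneous n \<Omega> (weight n 1) ?x" and y: "homogeneous n \<Omega> (weight n (n + 2)) ?y"
    using coord_indices_base[OF n] by (auto intro: homogeneous_t)
  \<comment> \<open>The power with exponent n + 2 is written as one factor times a product over the
    n + 1 indices \<open>{..n}\<close>.\<close>
  have "homogeneous n \<Omega> (weight n 1 + (\<Sum>i\<in>{..n}. weight n 1)) (\<lambda>p. ?x p * (\<Prod>i\<in>{..n}. ?x p))"
    by (intro homogeneous_mult_prod x) auto
  moreover have "weight n 1 + (\<Sum>i\<in>{..n}. weight n 1) = weight n (n + 2)"
    unfolding weight_base[OF n] by (simp add: algebra_simps)
  ultimately have "homogeneous n \<Omega> (weight n (n + 2)) (\<lambda>p. ?x p ^ (n + 2))" by simp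
  from homogeneous_add[OF y homogeneous_cmult[OF this, of "- 1"]]
  have "homogeneous n \<Omega> (weight n (n + 2)) (\<lambda>p. ?y p - ?x p ^ (n + 2))" by simp
  note xy = homogeneous_mult[OF y this]
  define I where "I = {i. (i, i) \<in> set (independent_positions n)}"
  have "I \<subseteq> {..n + 1}" by (auto simp: I_def set_independent_positions)
  then have I: "finite I" by (rule finite_subset) simp
  have "\<exists>w. homogeneous n \<Omega> w (S_fun n \<Omega> i i)" if "i \<in> I" for i
  proof -
    have "(i, i) \<in> set (independent_positions n)" using that by (simp add: I_def)
    then obtain j where "j \<in> coord_indices n" "j \<noteq> 1" "j \<noteq> n + 2" "position n j = (i, i)"
      by (rule ex_coord_position[OF n])
    then show ?thesis using homogeneous_t[of j n \<Omega>] by (auto simp: t_fun_def)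
  qed
  then obtain w where w: "\<And>i. i \<in> I \<Longrightarrow> homogeneous n \<Omega> (w i) (S_fun n \<Omega> i i)" by metis
  have "denom n \<Omega> = (\<lambda>p. ?y p * (?y p - ?x p ^ (n + 2)) * (\<Prod>i\<in>I. S_fun n \<Omega> i i p))"
    by (auto simp: denom_def on_T_def S_fun_def t_fun_def I_def)
  then show ?thesis using homogeneous_mult_prod[where f = "\<lambda>i. S_fun n \<Omega> i i", OF I w xy] by auto
qed

text \<open>Only the existence of components is recorded; the eigenvalues of the action separate
  them later.\<close>

definition decomposable ::
  "nat \<Rightarrow> (complex \<times> complex \<Rightarrow> complex mat) \<Rightarrow> (point \<Rightarrow> complex) \<Rightarrow> bool" where
  "decomposable n \<Omega> f \<longleftrightarrow>
    (\<exists>A F. finite A \<and> (\<forall>e. homogeneous n \<Omega> e (F e)) \<and> f = (\<lambda>p. \<Sum>e\<in>A. F e p))"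

lemma decomposable_homogeneous:
  assumes "homogeneous n \<Omega> e f"
  shows "decomposable n \<Omega> f"
  unfolding decomposable_def
  by (intro exI[of _ "{e}"] exI[of _ "\<lambda>d. if d = e then f else (\<lambda>p. 0)"])
    (use assms homogeneous_zero in auto)

lemma decomposable_add:
  assumes "decomposable n \<Omega> f" "decomposable n \<Omega> g"
  shows "decomposable n \<Omega> (\<lambda>p. f p + g p)"
proof -
  obtain A F where F: "finite A" "\<And>e. homogeneous n \<Omega> e (F e)" "f = (\<lambda>p. \<Sum>e\<in>A. F e p)"
    using assms(1) unfolding decomposable_def by blast
  obtain B G where G: "finite B" "\<And>e. homogeneous n \<Omega> e (G e)" "g = (\<lambda>p. \<Sum>e\<in>B. G e p)"
    using assms(2) unfolding decomposable_def by blast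
  \<comment> \<open>The cut-offs matter because \<open>F e\<close> need not vanish for
    \<open>e\<close> outside \<open>A\<close>, nor \<open>G e\<close> outside
    \<open>B\<close>.\<close>
  define H where "H e p = (if e \<in> A then F e p else 0) + (if e \<in> B then G e p else 0)" for e p
  have "homogeneous n \<Omega> e (H e)" for e
    using F(2) G(2) homogeneous_zero
    by (cases "e \<in> A"; cases "e \<in> B") (auto simp: H_def[abs_def] intro: homogeneous_add)
  moreover have "f p + g p = (\<Sum>e\<in>A \<union> B. H e p)" for p
  proof -
    have "(\<Sum>e\<in>A \<union> B. if e \<in> A then F e p else 0) = f p"
      unfolding F(3) by (intro sum.mono_neutral_cong_right) (use F(1) G(1) in auto)
    moreover have "(\<Sum>e\<in>A \<union> B. if e \<in> B then G e p else 0) = g p"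
      unfolding G(3) by (intro sum.mono_neutral_cong_right) (use F(1) G(1) in auto)
    ultimately show ?thesis by (simp add: H_def sum.distrib)
  qed
  ultimately show ?thesis unfolding decomposable_def using F(1) G(1) by blast
qed

lemma decomposable_sum:
  assumes "finite I" "\<And>i. i \<in> I \<Longrightarrow> decomposable n \<Omega> (f i)"
  shows "decomposable n \<Omega> (\<lambda>p. \<Sum>i\<in>I. f i p)"
  using assms
  by (induction I rule: finite_induct)
    (auto intro: decomposable_add decomposable_homogeneous[OF homogeneous_zero])

lemma decomposable_mult:
  assumes "decomposable n \<Omega> f" "decomposable n \<Omega> g"
  shows "decomposable n \<Omega> (\<lambda>p. f p * g p)"
proof -
  obtain A F where F: "finite A" "\<And>e. homogeneous n \<Omega> e (F e)" "f = (\<lambda>p. \<Sum>e\<in>A. F e p)"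
    using assms(1) unfolding decomposable_def by blast
  obtain B G where G: "finite B" "\<And>e. homogeneous n \<Omega> e (G e)" "g = (\<lambda>p. \<Sum>e\<in>B. G e p)"
    using assms(2) unfolding decomposable_def by blast
  \<comment> \<open>Each product is decomposable by itself, so coincidences among the degrees a + b
    need no bookkeeping.\<close>
  have "decomposable n \<Omega> (\<lambda>p. \<Sum>a\<in>A. \<Sum>b\<in>B. F a p * G b p)"
    by (intro decomposable_sum F(1) G(1) decomposable_homogeneous[OF homogeneous_mult[OF F(2) G(2)]])
  then show ?thesis by (simp add: F(3) G(3) sum_product)
qed

lemma regular_decomposable:
  assumes n: "n \<ge> 1" and f: "f \<in> regular n \<Omega>"
  shows "decomposable n \<Omega> f"
  using f
proof (induction rule: regular.induct)
  case regular_inverse_denom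
  then show ?case
    using homogeneous_denom[OF n] by (metis decomposable_homogeneous homogeneous_inverse_denom)
qed (auto intro: decomposable_homogeneous homogeneous_const homogeneous_t homogeneous_u
  decomposable_add decomposable_mult)

text \<open>Let U be composition with \<open>scale n 2\<close>. On the moduli space (U - 2^a)/(2^d -
  2^a) fixes \<open>f\<close> and the component of degree d, and kills that of degree a. Applied for
  each a other than d, it leaves f = F d.\<close>

lemma homogeneous_of_eigenfunction:
  assumes n: "n \<ge> 1" and \<Omega>: "intersection_matrix n c \<Omega>" and f: "f \<in> regular n \<Omega>"
    and eig: "\<And>p. p \<in> moduli_space n \<Omega> \<Longrightarrow> f (scale n 2 p) = 2 powi d * f p"
  shows "homogeneous n \<Omega> d f"
proof -
  \<comment> \<open>Norms reduce this to the strict monotonicity of integer powers of the real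
    number 2.\<close>
  have inj: "(2 :: complex) powi a \<noteq> 2 powi b" if "a \<noteq> b" for a b
  proof
    assume "(2 :: complex) powi a = 2 powi b"
    then have "norm ((2 :: complex) powi a) = norm ((2 :: complex) powi b)" by simp
    then have "(2 :: real) powi a = 2 powi b" by (simp add: norm_power_int)
    then show False using that power_int_strict_increasing[of a b "2 :: real"]
        power_int_strict_increasing[of b a "2 :: real"] by (cases a b rule: linorder_cases) auto
  qed
  have main: "homogeneous n \<Omega> d f"
    if "finite A" "d \<notin> A" "\<And>e. homogeneous n \<Omega> e (F e)" "\<And>p. f p = F d p + (\<Sum>e\<in>A. F e p)" for A F
    using that
  proof (induction A arbitrary: F rule: finite_induct)
    case empty
    then have "f = F d" by auto
    then show ?case using empty by simp
  next
    case (insert a A)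
    \<comment> \<open>The components after applying (U - 2^a)/(2^d - 2^a); the factor is 0 for e = a
      and 1 for e = d.\<close>
    define F' where "F' e p = (2 powi e - 2 powi a) / (2 powi d - 2 powi a) * F e p" for e p
    have da: "(2 :: complex) powi d - 2 powi a \<noteq> 0" using inj[of d a] insert.prems(1) by auto
    show ?case
    proof (rule insert.IH)
      show "d \<notin> A" using insert.prems(1) by simp
      show "homogeneous n \<Omega> e (F' e)" for e
        unfolding F'_def[abs_def] by (rule homogeneous_cmult) (rule insert.prems(2))
      show "f p = F' d p + (\<Sum>e\<in>A. F' e p)" for p
      proof (cases "p \<in> moduli_space n \<Omega>")
        case True
        have "f (scale n 2 p) = 2 powi d * F d p + 2 powi a * F a p + (\<Sum>e\<in>A. 2 powi e * F e p)"
          using insert.prems(3)[of "scale n 2 p"] homogeneous_scale[OF n \<Omega> _ insert.prems(2) True, of 2]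
            insert.hyps by (simp add: algebra_simps)
        moreover have "2 powi a * f p = 2 powi a * F d p + 2 powi a * F a p + (\<Sum>e\<in>A. 2 powi a * F e p)"
          using insert.prems(3)[of p] insert.hyps by (simp add: algebra_simps sum_distrib_left)
        ultimately have "(2 powi d - 2 powi a) * f p
            = (2 powi d - 2 powi a) * F d p + (\<Sum>e\<in>A. (2 powi e - 2 powi a) * F e p)"
          using eig[OF True] by (simp add: algebra_simps sum_subtractf)
        then have "f p = F d p + (\<Sum>e\<in>A. (2 powi e - 2 powi a) * F e p) / (2 powi d - 2 powi a)"
          using da by (simp add: field_simps)
        then show ?thesis using da by (simp add: F'_def sum_divide_distrib)
      next
        case False
        then show ?thesis
          using regular_vanishes[OF f False] homogeneous_vanishes[OF insert.prems(2) False]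
          by (simp add: F'_def)
      qed
    qed
  qed
  obtain A F where F: "finite A" "\<And>e. homogeneous n \<Omega> e (F e)" "f = (\<lambda>p. \<Sum>e\<in>A. F e p)"
    using regular_decomposable[OF n f] unfolding decomposable_def by blast
  show ?thesis
  proof (cases "d \<in> A")
    case True
    then show ?thesis by (intro main[of "A - {d}" F]) (use F in \<open>auto simp: sum.remove\<close>)
  next
    case False
    \<comment> \<open>A zero component in degree d brings the decomposition into the form required
      by \<open>main\<close>.\<close>
    then show ?thesis
      by (intro main[of A "F(d := (\<lambda>p. 0))"]) (use F homogeneous_zero in \<open>auto intro!: sum.cong\<close>)
  qed
qed

section \<open>Equivariance of the modular vector field\<close>

locale modular =
  fixes n :: nat and c :: complex and \<Omega> R Y
  assumes n: "n \<ge> 1" and \<Omega>: "intersection_matrix n c \<Omega>" and R: "vector_field n \<Omega> R"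
    and GM: "gauss_manin n \<Omega> R (Y_mat n Y)"
begin

definition superdiag :: "point \<Rightarrow> nat \<Rightarrow> complex" where
  "superdiag p i = (if i = 1 then 1 else if i = n then - 1 else Y (i - 1) p)"

abbreviation s :: "nat \<Rightarrow> nat \<Rightarrow> point \<Rightarrow> complex" where "s \<equiv> S_fun n \<Omega>"
abbreviation tx :: "point \<Rightarrow> complex" where "tx \<equiv> t_fun n \<Omega> 1"
abbreviation ty :: "point \<Rightarrow> complex" where "ty \<equiv> t_fun n \<Omega> (n + 2)"

definition BR :: "point \<Rightarrow> complex mat" where
  "BR p = B_mat n (tx p, ty p) (R tx p, R ty p)"

lemma R_entry:
  assumes p: "p \<in> moduli_space n \<Omega>" and ik: "i \<in> {1..n + 1}" "k \<in> {1..n + 1}"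
  shows "R (s i k) p = (if i \<le> n then superdiag p i * s (i + 1) k p else 0)
    - (\<Sum>l\<in>{1..n + 1}. s i l p * entry (BR p) l k)"
proof -
  obtain x y S where p_eq: "p = (x, y, S)" by (cases p)
  have S: "S \<in> carrier_mat (n + 1) (n + 1)" using p unfolding p_eq moduli_space_def by auto
  have sv: "s l m p = entry S l m" for l m using p by (simp add: S_fun_def on_T_def p_eq)
  have BR: "BR p = B_mat n (x, y) (R tx (x, y, S), R ty (x, y, S))"
    using p unfolding p_eq BR_def t_fun_def on_T_def by simp
  have B: "BR p \<in> carrier_mat (n + 1) (n + 1)" unfolding BR_def by (rule B_mat_carrier)
  have A: "Y_mat n Y p \<in> carrier_mat (n + 1) (n + 1)" by (simp only: Y_mat_def square_carrier)
  have "square (n + 1) (\<lambda>i j. R (s i j) p) = Y_mat n Y p * S - S * BR p"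
    using bspec[OF GM[unfolded gauss_manin_def] p] unfolding p_eq BR[unfolded p_eq] by simp
  then have "R (s i k) p = entry (Y_mat n Y p * S - S * BR p) i k"
    using entry_square[OF ik, of "\<lambda>i j. R (s i j) p"] by simp
  also have "\<dots> = (\<Sum>l\<in>{1..n + 1}. entry (Y_mat n Y p) i l * entry S l k)
      - (\<Sum>l\<in>{1..n + 1}. entry S i l * entry (BR p) l k)"
    using A B S by (simp only: entry_minus[OF _ _ ik] mult_carrier_mat entry_mult[OF _ _ ik])
  also have "(\<Sum>l\<in>{1..n + 1}. entry (Y_mat n Y p) i l * entry S l k)
      = (\<Sum>l\<in>{1..n + 1}. if i + 1 = l then superdiag p i * entry S l k else 0)"
    by (intro sum.cong refl) (auto simp: Y_mat_def entry_square[OF ik(1)] superdiag_def simp del: One_nat_def)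
  also have "\<dots> = (if i \<le> n then superdiag p i * s (i + 1) k p else 0)"
    unfolding sum.delta'[OF finite_atLeastAtMost] sv by auto
  finally show ?thesis by (simp only: sv)
qed

text \<open>The rules of \<open>vector_field\<close> apply to regular functions, so zero is
  presented as 0 times a regular constant.\<close>

lemma R_zero: "R (\<lambda>p. 0) = (\<lambda>p. 0)"
proof -
  have "R (\<lambda>p. 0 * on_T n \<Omega> (\<lambda>p. 0) p) = (\<lambda>p. 0 * R (on_T n \<Omega> (\<lambda>p. 0)) p)"
    using R regular_const[of n \<Omega> 0] unfolding vector_field_def by blast
  then show ?thesis by simp
qed

section \<open>Solving the normalization of \<open>S\<close> for R(t_1), R(t_(n+2)) and Y\<close>

lemma S_upper: "i \<in> {1..n + 1} \<Longrightarrow> k \<in> {1..n + 1} \<Longrightarrow> i < k \<Longrightarrow> s i k = (\<lambda>p. 0)"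
  by (auto simp: S_fun_def on_T_def moduli_space_def fun_eq_iff)

lemma S_first: "p \<in> moduli_space n \<Omega> \<Longrightarrow> s 1 1 p = 1"
  by (auto simp: S_fun_def on_T_def moduli_space_def)

lemma S_diag:
  assumes p: "p \<in> moduli_space n \<Omega>" and i: "i \<in> {1..n + 1}"
  shows "s i i p \<noteq> 0"
proof -
  obtain x y S where p_eq: "p = (x, y, S)" by (cases p)
  have "entry S i i \<noteq> 0"
    using p unfolding p_eq moduli_space_def
    by (intro lower_triangular_diagonal_nonzero[of S "n + 1"]) (use i in auto)
  then show ?thesis using p by (simp add: S_fun_def on_T_def p_eq)
qed

text \<open>On the moduli space s_11 is the unit of the ring, an idempotent e, and a derivation
  gives R(e) = 2 e R(e).\<close>

lemma R_S_first:
  assumes p: "p \<in> moduli_space n \<Omega>"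
  shows "R (s 1 1) p = 0"
proof -
  have 1: "s 1 1 = on_T n \<Omega> (\<lambda>p. 1)"
    by (auto simp: S_fun_def on_T_def moduli_space_def fun_eq_iff)
  have reg: "s 1 1 \<in> regular n \<Omega>" unfolding 1 by (rule regular_const)
  have "(\<lambda>p. s 1 1 p * s 1 1 p) = s 1 1" unfolding 1 by (auto simp: on_T_def)
  moreover have "R (\<lambda>p. s 1 1 p * s 1 1 p) = (\<lambda>p. R (s 1 1) p * s 1 1 p + s 1 1 p * R (s 1 1) p)"
    using R reg unfolding vector_field_def by blast
  ultimately have "R (s 1 1) p = R (s 1 1) p * s 1 1 p + s 1 1 p * R (s 1 1) p"
    by (metis (no_types, lifting))
  then show ?thesis using S_first[OF p] by simp
qed

lemma BR_entry:
  assumes ij: "i \<in> {1..n}" "j \<in> {1..n + 1}"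
  shows "entry (BR p) i j =
    (if j = i then - of_nat i / (of_nat (n + 2) * ty p) * R ty p
     else if j = i + 1 then R tx p - tx p / (of_nat (n + 2) * ty p) * R ty p else 0)"
proof -
  have "i \<in> {1..n + 1}" using ij by simp
  then show ?thesis using ij unfolding BR_def B_mat.simps by (subst entry_square) auto
qed

lemma index_nonzero: "(of_nat (n + 2) :: complex) \<noteq> 0"
  unfolding of_nat_eq_0_iff by simp

lemma ty_nonzero: "p \<in> moduli_space n \<Omega> \<Longrightarrow> ty p \<noteq> 0"
  by (auto simp: t_fun_def on_T_def moduli_space_def base_def)

text \<open>The first row of \<open>S\<close> is (1, 0, ..., 0), so the entry (1, 1) of R(S) = Y S -
  S B(R) reads 0 = s_21 - B(R)_11, and B(R)_11 involves only dt_(n+2).\<close>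

lemma R_ty:
  assumes p: "p \<in> moduli_space n \<Omega>"
  shows "R ty p = - of_nat (n + 2) * ty p * s 2 1 p"
proof -
  have "(\<Sum>l\<in>{1..n + 1}. s 1 l p * entry (BR p) l 1)
      = (\<Sum>l\<in>{1..n + 1}. if 1 = l then entry (BR p) l 1 else 0)"
  proof (intro sum.cong refl)
    fix l assume l: "l \<in> {1..n + 1}"
    show "s 1 l p * entry (BR p) l 1 = (if 1 = l then entry (BR p) l 1 else 0)"
      using S_first[OF p] S_upper[OF _ l, of 1] l by (cases "l = 1") auto
  qed
  also have "\<dots> = entry (BR p) 1 1"
    unfolding sum.delta'[OF finite_atLeastAtMost] by simp
  finally have "0 = s 2 1 p - entry (BR p) 1 1"
    using R_entry[OF p, of 1 1] R_S_first[OF p] n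
    by (simp add: superdiag_def numeral_2_eq_2)
  moreover have "entry (BR p) 1 1 = - 1 / (of_nat (n + 2) * ty p) * R ty p"
    using BR_entry[of 1 1 p] n by simp
  ultimately have *: "s 2 1 p = - 1 / (of_nat (n + 2) * ty p) * R ty p" by simp
  have "R ty p = - N * ty p * (- 1 / (N * ty p) * R ty p)" if "N \<noteq> 0" for N
    using that ty_nonzero[OF p] by simp
  from this[OF index_nonzero] show ?thesis unfolding * .
qed

text \<open>The entry (i, i + 1) of \<open>S\<close> is zero, hence so is its derivative. In S B(R)
  triangularity leaves l \<le> i, which excludes the full last row of B, and the remaining rows of B
  are bidiagonal, leaving l = i.\<close>

lemma superdiag_recursion:
  assumes p: "p \<in> moduli_space n \<Omega>" and i: "i \<in> {1..n}"
  shows "superdiag p i * s (i + 1) (i + 1) p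
    = s i i p * (R tx p - tx p / (of_nat (n + 2) * ty p) * R ty p)"
proof -
  let ?\<beta> = "R tx p - tx p / (of_nat (n + 2) * ty p) * R ty p"
  have i': "i \<in> {1..n + 1}" "i + 1 \<in> {1..n + 1}" using i by auto
  have "(\<Sum>l\<in>{1..n + 1}. s i l p * entry (BR p) l (i + 1))
      = (\<Sum>l\<in>{1..n + 1}. if i = l then s i i p * ?\<beta> else 0)"
  proof (intro sum.cong refl)
    fix l assume l: "l \<in> {1..n + 1}"
    show "s i l p * entry (BR p) l (i + 1) = (if i = l then s i i p * ?\<beta> else 0)"
    proof (cases "l \<le> i")
      case True
      then show ?thesis using BR_entry[of l "i + 1" p] l i by auto
    next
      case False
      then show ?thesis using S_upper[OF i'(1) l] by auto
    qed
  qed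
  also have "\<dots> = s i i p * ?\<beta>"
    unfolding sum.delta'[OF finite_atLeastAtMost] using i by simp
  finally show ?thesis
    using R_entry[OF p i'] R_zero S_upper[OF i'] i by simp
qed

text \<open>The recursion at i = 1, where the superdiagonal entry and s_11 are both 1.\<close>

lemma R_tx:
  assumes p: "p \<in> moduli_space n \<Omega>"
  shows "R tx p = s 2 2 p - tx p * s 2 1 p"
proof -
  have "superdiag p 1 * s 2 2 p = R tx p - tx p / (of_nat (n + 2) * ty p) * R ty p"
    using superdiag_recursion[OF p, of 1] S_first[OF p] n by (simp add: numeral_2_eq_2)
  also have "tx p / (of_nat (n + 2) * ty p) * R ty p = - (tx p * s 2 1 p)"
  proof -
    have "a / (N * ty p) * (- N * ty p * b) = - (a * b)" if "N \<noteq> 0" for N a b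
      using that ty_nonzero[OF p] by simp
    from this[OF index_nonzero] show ?thesis unfolding R_ty[OF p] .
  qed
  finally show ?thesis by (simp add: superdiag_def)
qed

section \<open>Weights of R(S) and its ingredients under a scalar z\<close>

context
  fixes z :: complex and p :: point
  assumes z: "z \<noteq> 0" and p: "p \<in> moduli_space n \<Omega>"
begin

text \<open>Degree 2 originates here: s_21 has weight 2 for every n, and it is the factor by which
  R(t_(n+2)) exceeds t_(n+2); the weight of s_22 makes R(t_1) consistent with it.\<close>

lemma entry_weight_second: "entry_weight n 2 1 = 2" "entry_weight n 2 2 = 2 + int (base_weight n)"
  using n by (auto simp: entry_weight_def row_weight_def base_weight_def)

lemma in_T: "scale n z p \<in> moduli_space n \<Omega>"
  by (rule scale_moduli_space[OF n \<Omega> z p])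

lemmas s_scale = S_fun_scale[OF in_T p z]

lemma t_scale: "tx (scale n z p) = z ^ base_weight n * tx p"
    "ty (scale n z p) = (z ^ base_weight n) ^ (n + 2) * ty p"
  using t_fun_base_scale[OF in_T p n] unfolding weight_base[OF n] power_int_of_nat power_mult .

lemma s2_scale: "s 2 1 (scale n z p) = z ^ 2 * s 2 1 p"
    "s 2 2 (scale n z p) = z ^ 2 * z ^ base_weight n * s 2 2 p"
  using s_scale[of 2 1, unfolded entry_weight_second] s_scale[of 2 2, unfolded entry_weight_second] n z
  by (simp_all add: power_int_add)

lemma R_t_scale:
  "R tx (scale n z p) = z ^ base_weight n * z ^ 2 * R tx p"
  "R ty (scale n z p) = (z ^ base_weight n) ^ (n + 2) * z ^ 2 * R ty p"
  unfolding R_tx[OF in_T] R_tx[OF p] R_ty[OF in_T] R_ty[OF p] t_scale s2_scale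
  by (simp_all only: right_diff_distrib mult_ac)

text \<open>By \<open>R_t_scale\<close> the tangent vector R scales like the base point up to
  \<open>z ^ 2\<close>, so \<open>B_mat_scale\<close> applies with \<kappa> =
  \<open>z ^ 2\<close>.\<close>

lemma BR_scale:
  assumes "i \<in> {1..n + 1}" "j \<in> {1..n + 1}"
  shows "entry (BR (scale n z p)) i j * (z ^ base_weight n) ^ i
    = z ^ 2 * (z ^ base_weight n) ^ j * entry (BR p) i j"
proof -
  have "(tx p, ty p) \<in> base n"
    using p by (auto simp: t_fun_def on_T_def moduli_space_def)
  then show ?thesis unfolding BR_def t_scale R_t_scale
    by (intro B_mat_scale assms) (simp_all add: z)
qed

text \<open>Both sides of \<open>superdiag_recursion\<close> have known weights, except for the
  superdiagonal entry; the nonzero s_(i+1)(i+1) can be cancelled.\<close>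

lemma superdiag_scale:
  assumes i: "i \<in> {1..n}"
  shows "superdiag (scale n z p) i * z powi row_weight n (i + 1)
    = z ^ 2 * z powi row_weight n i * superdiag p i"
proof -
  define \<mu> where "\<mu> = z ^ base_weight n"
  have \<mu>: "\<mu> \<noteq> 0" using z by (simp add: \<mu>_def)
  have i': "i \<in> {1..n + 1}" "i + 1 \<in> {1..n + 1}" using i by auto
  let ?\<beta> = "\<lambda>p. R tx p - tx p / (of_nat (n + 2) * ty p) * R ty p"
  have "?\<beta> (scale n z p) = \<mu> * z ^ 2 * ?\<beta> p"
  proof -
    have "\<mu> * z ^ 2 * a - \<mu> * x / (N * (P * ty p)) * (P * z ^ 2 * b) = \<mu> * z ^ 2 * (a - x / (N * ty p) * b)"
      if "N \<noteq> 0" "P \<noteq> 0" for N P a b x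
      using that ty_nonzero[OF p] by (simp add: field_simps)
    from this[OF index_nonzero, of "\<mu> ^ (n + 2)"] show ?thesis
      using \<mu> unfolding R_t_scale t_scale \<mu>_def[symmetric] by simp
  qed
  then have "superdiag (scale n z p) i * s (i + 1) (i + 1) (scale n z p)
      = s i i (scale n z p) * (\<mu> * z ^ 2 * ?\<beta> p)"
    using superdiag_recursion[OF in_T i] by simp
  also have "\<dots> = z powi row_weight n i * \<mu> ^ (i + 1) * z ^ 2 * (s i i p * ?\<beta> p)"
    unfolding s_scale[OF i'(1) i'(1)] powi_entry_weight[OF z] \<mu>_def[symmetric] by (simp add: mult_ac)
  finally have "superdiag (scale n z p) i * (z powi row_weight n (i + 1) * \<mu> ^ (i + 1) * s (i + 1) (i + 1) p)
      = z powi row_weight n i * \<mu> ^ (i + 1) * z ^ 2 * (superdiag p i * s (i + 1) (i + 1) p)"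
    unfolding s_scale[OF i'(2) i'(2)] powi_entry_weight[OF z] \<mu>_def[symmetric] superdiag_recursion[OF p i] .
  then have "(superdiag (scale n z p) i * z powi row_weight n (i + 1)) * (\<mu> ^ (i + 1) * s (i + 1) (i + 1) p)
      = (z ^ 2 * z powi row_weight n i * superdiag p i) * (\<mu> ^ (i + 1) * s (i + 1) (i + 1) p)"
    by (simp only: mult_ac)
  then show ?thesis using \<mu> S_diag[OF p i'(2)] by simp
qed

text \<open>All summands of \<open>R_entry\<close> scale alike: in Y S the superdiagonal entry
  trades the row factor i + 1 for i, in S B(R) the matrix trades the column factor \<mu>^l for
  \<mu>^k, and each trade costs \<open>z ^ 2\<close>.\<close>

lemma R_s_scale:
  assumes ik: "i \<in> {1..n + 1}" "k \<in> {1..n + 1}"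
  shows "R (s i k) (scale n z p) = z ^ 2 * z powi entry_weight n i k * R (s i k) p"
proof -
  define \<mu> where "\<mu> = z ^ base_weight n"
  define g where "g i = z powi row_weight n i" for i
  note ew = powi_entry_weight[OF z, where n = n, folded \<mu>_def g_def]
  note sc = s_scale[unfolded ew]
  have "superdiag (scale n z p) i * s (i + 1) k (scale n z p)
      = z ^ 2 * (g i * \<mu> ^ k) * (superdiag p i * s (i + 1) k p)" if "i \<le> n"
  proof -
    have i: "i \<in> {1..n}" "i + 1 \<in> {1..n + 1}" using that ik by auto
    have "superdiag (scale n z p) i * s (i + 1) k (scale n z p)
        = (superdiag (scale n z p) i * g (i + 1)) * (\<mu> ^ k * s (i + 1) k p)"
      unfolding sc[OF i(2) ik(2)] by (simp only: mult_ac)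
    also have "\<dots> = (z ^ 2 * g i * superdiag p i) * (\<mu> ^ k * s (i + 1) k p)"
      unfolding superdiag_scale[OF i(1), folded g_def] ..
    finally show ?thesis by (simp only: mult_ac)
  qed
  then have 1: "(if i \<le> n then superdiag (scale n z p) i * s (i + 1) k (scale n z p) else 0)
      = z ^ 2 * (g i * \<mu> ^ k) * (if i \<le> n then superdiag p i * s (i + 1) k p else 0)" by simp
  have 2: "s i l (scale n z p) * entry (BR (scale n z p)) l k
      = z ^ 2 * (g i * \<mu> ^ k) * (s i l p * entry (BR p) l k)" if l: "l \<in> {1..n + 1}" for l
  proof -
    have "s i l (scale n z p) * entry (BR (scale n z p)) l k
        = g i * s i l p * (entry (BR (scale n z p)) l k * \<mu> ^ l)"
      unfolding sc[OF ik(1) l] by (simp only: mult_ac)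
    also have "\<dots> = g i * s i l p * (z ^ 2 * \<mu> ^ k * entry (BR p) l k)"
      unfolding BR_scale[OF l ik(2), folded \<mu>_def] ..
    finally show ?thesis by (simp only: mult_ac)
  qed
  show ?thesis
    unfolding R_entry[OF in_T ik] R_entry[OF p ik] ew 1 right_diff_distrib sum_distrib_left
    by (intro arg_cong2[where f = minus] refl sum.cong 2)
qed

end

section \<open>Homogeneity of the coefficients of R\<close>

lemma R_coord_homogeneous:
  assumes j: "j \<in> coord_indices n"
  shows "homogeneous n \<Omega> (weight n j + 2) (R (t_fun n \<Omega> j))"
proof (rule homogeneous_of_eigenfunction[OF n \<Omega>])
  show "R (t_fun n \<Omega> j) \<in> regular n \<Omega>"
    using R regular_t[OF j] unfolding vector_field_def by blast
  fix p assume p: "p \<in> moduli_space n \<Omega>"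
  have w: "(2 :: complex) powi (weight n j + 2) = 2 powi weight n j * 2 ^ 2"
    by (simp add: power_int_add)
  consider "j = 1" | "j = n + 2" | "j \<noteq> 1" "j \<noteq> n + 2" by blast
  then show "R (t_fun n \<Omega> j) (scale n 2 p) = 2 powi (weight n j + 2) * R (t_fun n \<Omega> j) p"
  proof cases
    case 1
    show ?thesis
      unfolding w unfolding 1 weight_base[OF n] power_int_of_nat
      by (rule R_t_scale(1)[OF _ p]) simp
  next
    case 2
    show ?thesis
      unfolding w unfolding 2 weight_base[OF n] power_int_of_nat power_mult
      by (rule R_t_scale(2)[OF _ p]) simp
  next
    case 3
    then obtain i k where ik: "i \<in> {1..n + 1}" "k \<in> {1..n + 1}"
      and t: "t_fun n \<Omega> j = s i k" "weight n j = entry_weight n i k"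
      using t_fun_coord[OF n j] by metis
    show ?thesis
      unfolding w unfolding t using R_s_scale[OF _ p ik, of 2] by (simp add: mult_ac)
  qed
qed

end

theorem proposition3p1:
  fixes n :: nat and c :: complex
    and \<Omega> :: "complex \<times> complex \<Rightarrow> complex mat"
    and R :: "(point \<Rightarrow> complex) \<Rightarrow> (point \<Rightarrow> complex)"
  assumes "n \<ge> 1" and "c \<noteq> 0"
    and "intersection_matrix n c \<Omega>"
    and "modular_vector_field n \<Omega> R"
  shows "quasi_homogeneous n \<Omega> 2 R"
proof -
  obtain Y where "vector_field n \<Omega> R" "gauss_manin n \<Omega> R (Y_mat n Y)"
    using assms(4) unfolding modular_vector_field_def by blast
  then interpret modular n c \<Omega> R Y
    using assms by unfold_locales
  show ?thesis
    unfolding quasi_homogeneous_def using R_coord_homogeneous by blast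
qed

end
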